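(* Let $n\ge 2$, let $X_1,\dots,X_n$ be real Hilbert spaces and $\mathbf{X}=X_1\times\cdots\times X_n$. Let $A_i\colon X_i\to X_i'$ ($i=1,\dots,n$) be bounded, self-adjoint, positive semi-definite linear operators and $B_i\colon X_i\to X_{i+1}'$ ($i=1,\dots,n-1$) bounded linear operators. Assume that the Schur complements $S_1=A_1$, $S_{i+1}=A_{i+1}+B_iS_i^{-1}B_i'$ ($i=1,\dots,n-1$) are well-defined and positive definite, i.e. there are constants $\sigma_i>0$ with $\langle S_ix_i,x_i\rangle\ge\sigma_i\|x_i\|_{X_i}^2$ for all $x_i\in X_i$, $i=1,\dots,n$. Let $\mathcal{A}\colon\mathbf{X}\to\mathbf{X}'$ be the block tridiagonal operator with diagonal blocks $(-1)^{i-1}A_i$, subdiagonal blocks $B_i$ (in position $(i+1,i)$) and superdiagonal blocks $B_i'$ (in position $(i,i+1)$), let $\mathcal{S}=\operatorname{diag}(S_1,\dots,S_n)$ and $\mathcal{M}=\mathcal{S}^{-1}\mathcal{A}\colon\mathbf{X}\to\mathbf{X}$. Then $\mathcal{M}$ is invertible and $$\|\mathcal{M}^{-1}\|_{\mathcal{L}(\mathbf{X},\mathbf{X})}\le\frac{1}{2\sin\left(\frac{\pi}{2(2n+1)}\right)},$$ where $\mathbf{X}$ is equipped with the norm $\|\cdot\|_{\mathcal{S}}$.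
   Context: $X'$ is the dual of $X$ and $\langle\cdot,\cdot\rangle$ the duality product. For a bounded operator $B\colon X\to Y'$, the adjoint $B'\colon Y\to X'$ is given by $\langle B'y,x\rangle=\langle Bx,y\rangle$ for all $x\in X,\ y\in Y$. $A_i$ is self-adjoint and positive semi-definite if $\langle A_iy_i,x_i\rangle=\langle A_ix_i,y_i\rangle$ and $\langle A_ix_i,x_i\rangle\ge0$ for all $x_i,y_i\in X_i$. The norm $\|\cdot\|_{\mathcal{S}}$ on $\mathbf{X}$ is induced by the inner product $(\mathbf{x},\mathbf{y})_{\mathcal{S}}=\langle\mathcal{S}\mathbf{x},\mathbf{y}\rangle=\sum_{i=1}^n\langle S_ix_i,y_i\rangle$. $\mathcal{L}(\mathbf{X},\mathbf{X})$ is the space of bounded linear operators on $(\mathbf{X},\|\cdot\|_{\mathcal{S}})$ with the operator norm. *)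

theory Defs
  imports "HOL-Analysis.Analysis"
begin

text \<open>
  A family of Hilbert spaces of varying type cannot be indexed by a natural number, so the spaces
  are complete linear subspaces of one inner product space, with the inherited inner product.
  This is no restriction: any finite family of real Hilbert spaces embeds isometrically into its
  orthogonal direct sum.  The subspaces are not assumed to be related to each other in any way.
\<close>

definition hilbert_subspace :: "'h::real_inner set \<Rightarrow> bool" where
  "hilbert_subspace X \<longleftrightarrow> subspace X \<and> complete X"

text \<open>
  The dual space of \<open>X\<close> consists of functionals on \<open>X\<close>; \<open>extensional\<close> makes equality of functionals
  coincide with equality on \<open>X\<close>.  The duality product of \<open>f\<close> and \<open>x\<close> is \<open>f x\<close>.
\<close>

definition dual_space :: "'h::real_inner set \<Rightarrow> ('h \<Rightarrow> real) set" where
  "dual_space X = {f \<in> extensional X.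
     (\<forall>x\<in>X. \<forall>y\<in>X. f (x + y) = f x + f y) \<and>
     (\<forall>c. \<forall>x\<in>X. f (c *\<^sub>R x) = c * f x) \<and>
     (\<exists>K. \<forall>x\<in>X. \<bar>f x\<bar> \<le> K * norm x)}"

definition dual_norm :: "'h::real_inner set \<Rightarrow> ('h \<Rightarrow> real) \<Rightarrow> real" where
  "dual_norm X f = (SUP x\<in>X. \<bar>f x\<bar> / norm x)"

text \<open>Bounded linear operators from \<open>X\<close> to the dual of \<open>Y\<close>.\<close>

definition bounded_linear_dual ::
    "'h::real_inner set \<Rightarrow> 'h set \<Rightarrow> ('h \<Rightarrow> 'h \<Rightarrow> real) \<Rightarrow> bool" where
  "bounded_linear_dual X Y T \<longleftrightarrow>
     (\<forall>x\<in>X. T x \<in> dual_space Y) \<and>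
     (\<forall>x\<in>X. \<forall>x'\<in>X. \<forall>y\<in>Y. T (x + x') y = T x y + T x' y) \<and>
     (\<forall>c. \<forall>x\<in>X. \<forall>y\<in>Y. T (c *\<^sub>R x) y = c * T x y) \<and>
     (\<exists>K. \<forall>x\<in>X. dual_norm Y (T x) \<le> K * norm x)"

text \<open>The adjoint of an operator \<open>B\<close> from \<open>X\<close> to the dual of some \<open>Y\<close>, mapping \<open>Y\<close> to the dual of \<open>X\<close>.\<close>

definition dual_adjoint :: "'h set \<Rightarrow> ('h \<Rightarrow> 'h \<Rightarrow> real) \<Rightarrow> 'h \<Rightarrow> 'h \<Rightarrow> real" where
  "dual_adjoint X B = (\<lambda>y. \<lambda>x\<in>X. B x y)"

definition self_adjoint_on :: "'h set \<Rightarrow> ('h \<Rightarrow> 'h \<Rightarrow> real) \<Rightarrow> bool" where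
  "self_adjoint_on X A \<longleftrightarrow> (\<forall>x\<in>X. \<forall>y\<in>X. A y x = A x y)"

definition pos_semidef_on :: "'h set \<Rightarrow> ('h \<Rightarrow> 'h \<Rightarrow> real) \<Rightarrow> bool" where
  "pos_semidef_on X A \<longleftrightarrow> (\<forall>x\<in>X. A x x \<ge> 0)"

definition pos_def_on :: "'h::real_inner set \<Rightarrow> ('h \<Rightarrow> 'h \<Rightarrow> real) \<Rightarrow> bool" where
  "pos_def_on X A \<longleftrightarrow> (\<exists>\<sigma>>0. \<forall>x\<in>X. A x x \<ge> \<sigma> * (norm x)\<^sup>2)"

text \<open>
  Blocks are numbered \<open>0, \<dots>, n - 1\<close>: \<open>X i\<close>, \<open>A i\<close>, \<open>B i\<close>, \<open>schur X A B i\<close> are the objects that are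
  usually given the index \<open>i + 1\<close>.  Thus \<open>B i\<close> maps \<open>X i\<close> to the dual of \<open>X (Suc i)\<close>.
\<close>

primrec schur ::
    "(nat \<Rightarrow> 'h set) \<Rightarrow> (nat \<Rightarrow> 'h \<Rightarrow> 'h \<Rightarrow> real) \<Rightarrow> (nat \<Rightarrow> 'h \<Rightarrow> 'h \<Rightarrow> real) \<Rightarrow>
     nat \<Rightarrow> 'h \<Rightarrow> 'h \<Rightarrow> real" where
  "schur X A B 0 = A 0"
| "schur X A B (Suc i) = (\<lambda>x. \<lambda>y\<in>X (Suc i).
     A (Suc i) x y + B i (inv_into (X i) (schur X A B i) (dual_adjoint (X i) (B i) x)) y)"

definition prod_space :: "nat \<Rightarrow> (nat \<Rightarrow> 'h set) \<Rightarrow> (nat \<Rightarrow> 'h) set" where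
  "prod_space n X = (\<Pi>\<^sub>E i\<in>{..<n}. X i)"

text \<open>The block in row \<open>i\<close> and column \<open>j\<close>, an operator from \<open>X j\<close> to the dual of \<open>X i\<close>.\<close>

definition tridiag_block ::
    "(nat \<Rightarrow> 'h set) \<Rightarrow> (nat \<Rightarrow> 'h \<Rightarrow> 'h \<Rightarrow> real) \<Rightarrow> (nat \<Rightarrow> 'h \<Rightarrow> 'h \<Rightarrow> real) \<Rightarrow>
     nat \<Rightarrow> nat \<Rightarrow> 'h \<Rightarrow> 'h \<Rightarrow> real" where
  "tridiag_block X A B i j =
     (if i = j then (\<lambda>x. \<lambda>y\<in>X i. (-1) ^ i * A i x y)
      else if i = Suc j then B j
      else if j = Suc i then dual_adjoint (X i) (B i)
      else (\<lambda>x. \<lambda>y\<in>X i. 0))"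

text \<open>
  Both block operators take values in the dual of the product space: an element of it is a functional
  on tuples \<open>y\<close>, and the component in the dual of \<open>X i\<close> is applied to \<open>y i\<close>.
\<close>

definition tridiag_op ::
    "nat \<Rightarrow> (nat \<Rightarrow> 'h set) \<Rightarrow> (nat \<Rightarrow> 'h \<Rightarrow> 'h \<Rightarrow> real) \<Rightarrow> (nat \<Rightarrow> 'h \<Rightarrow> 'h \<Rightarrow> real) \<Rightarrow>
     (nat \<Rightarrow> 'h) \<Rightarrow> (nat \<Rightarrow> 'h) \<Rightarrow> real" where
  "tridiag_op n X A B = (\<lambda>x. \<lambda>y\<in>prod_space n X.
     \<Sum>i<n. \<Sum>j<n. tridiag_block X A B i j (x j) (y i))"

definition schur_op ::
    "nat \<Rightarrow> (nat \<Rightarrow> 'h set) \<Rightarrow> (nat \<Rightarrow> 'h \<Rightarrow> 'h \<Rightarrow> real) \<Rightarrow> (nat \<Rightarrow> 'h \<Rightarrow> 'h \<Rightarrow> real) \<Rightarrow>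
     (nat \<Rightarrow> 'h) \<Rightarrow> (nat \<Rightarrow> 'h) \<Rightarrow> real" where
  "schur_op n X A B = (\<lambda>x. \<lambda>y\<in>prod_space n X. \<Sum>i<n. schur X A B i (x i) (y i))"

definition precond_op ::
    "nat \<Rightarrow> (nat \<Rightarrow> 'h set) \<Rightarrow> (nat \<Rightarrow> 'h \<Rightarrow> 'h \<Rightarrow> real) \<Rightarrow> (nat \<Rightarrow> 'h \<Rightarrow> 'h \<Rightarrow> real) \<Rightarrow>
     (nat \<Rightarrow> 'h) \<Rightarrow> (nat \<Rightarrow> 'h)" where
  "precond_op n X A B x = inv_into (prod_space n X) (schur_op n X A B) (tridiag_op n X A B x)"

definition schur_norm ::
    "nat \<Rightarrow> (nat \<Rightarrow> 'h set) \<Rightarrow> (nat \<Rightarrow> 'h \<Rightarrow> 'h \<Rightarrow> real) \<Rightarrow> (nat \<Rightarrow> 'h \<Rightarrow> 'h \<Rightarrow> real) \<Rightarrow>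
     (nat \<Rightarrow> 'h) \<Rightarrow> real" where
  "schur_norm n X A B x = sqrt (schur_op n X A B x x)"

text \<open>
  Bounded linear operators on the product space with a given norm \<open>N\<close>, and the operator norm.
  The supremum is meaningful only for bounded operators; as in \<open>onorm\<close>, the quotient is \<open>0\<close> at the
  zero vector.
\<close>

definition bounded_ops ::
    "nat \<Rightarrow> (nat \<Rightarrow> 'h::real_vector set) \<Rightarrow> ((nat \<Rightarrow> 'h) \<Rightarrow> real) \<Rightarrow>
     ((nat \<Rightarrow> 'h) \<Rightarrow> (nat \<Rightarrow> 'h)) set" where
  "bounded_ops n X N = {T \<in> prod_space n X \<rightarrow> prod_space n X.
     (\<forall>x\<in>prod_space n X. \<forall>y\<in>prod_space n X.
        T (\<lambda>i\<in>{..<n}. x i + y i) = (\<lambda>i\<in>{..<n}. T x i + T y i)) \<and>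
     (\<forall>c. \<forall>x\<in>prod_space n X.
        T (\<lambda>i\<in>{..<n}. c *\<^sub>R x i) = (\<lambda>i\<in>{..<n}. c *\<^sub>R T x i)) \<and>
     (\<exists>K. \<forall>x\<in>prod_space n X. N (T x) \<le> K * N x)}"

definition op_norm ::
    "nat \<Rightarrow> (nat \<Rightarrow> 'h set) \<Rightarrow> ((nat \<Rightarrow> 'h) \<Rightarrow> real) \<Rightarrow> ((nat \<Rightarrow> 'h) \<Rightarrow> (nat \<Rightarrow> 'h)) \<Rightarrow> real" where
  "op_norm n X N T = (SUP x\<in>prod_space n X. N (T x) / N x)"

end

theory Submission
  imports Defs
begin

text \<open>
  With respect to the scalar products given by the Schur complements, block elimination factors the
  preconditioned operator as \<open>L D L'\<close>, where \<open>D\<close> is the diagonal of alternating signs and \<open>L\<close> is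
  unit lower bidiagonal with off-diagonal entries that are contractions, because
  \<open>S\<^sub>i\<^sub>+\<^sub>1 - B\<^sub>i S\<^sub>i\<inverse> B\<^sub>i' = A\<^sub>i\<^sub>+\<^sub>1 \<ge> 0\<close>.  Its inverse \<open>T\<close> is symmetric, so the norm of \<open>T\<close> is the
  supremum of the quadratic form of \<open>T\<close>; with \<open>f = L D g\<close> the bound becomes
  \<open>\<mu> * (\<Sum>i. (-1)\<^sup>i * \<parallel>g\<^sub>i\<parallel>\<^sup>2) \<le> \<parallel>f\<parallel>\<^sup>2\<close> for \<open>\<mu>\<close> equal to plus or minus \<open>2 * sin (pi / (2 * (2 * n + 1)))\<close>.
  Completing squares from the first block on reduces this to the
  nonnegativity of \<open>t\<^sub>k - 1\<close> for \<open>t\<^sub>k\<^sub>+\<^sub>1 = 2 \<plusminus> \<mu> - 1 / t\<^sub>k\<close>, a Riccati recurrence with an explicit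
  trigonometric solution.
\<close>

subsection \<open>Scalar products on subspaces\<close>

text \<open>The forms are functions on the whole type but constrained only on \<open>X\<close>, so
  the scalar product is axiomatized relative to the subspace instead of as an instance of
  \<open>real_inner\<close>.\<close>

locale scalar_product =
  fixes X :: "'h::real_inner set" and s :: "'h \<Rightarrow> 'h \<Rightarrow> real"
  assumes subspace: "subspace X"
    and add_left: "\<lbrakk>x \<in> X; y \<in> X; z \<in> X\<rbrakk> \<Longrightarrow> s (x + y) z = s x z + s y z"
    and scale_left: "\<lbrakk>x \<in> X; z \<in> X\<rbrakk> \<Longrightarrow> s (c *\<^sub>R x) z = c * s x z"
    and commute: "\<lbrakk>x \<in> X; y \<in> X\<rbrakk> \<Longrightarrow> s x y = s y x"
    and nonneg: "x \<in> X \<Longrightarrow> 0 \<le> s x x"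
    and definite: "\<lbrakk>x \<in> X; s x x = 0\<rbrakk> \<Longrightarrow> x = 0"
begin

lemma mem [simp, intro]:
  "0 \<in> X"
  "\<lbrakk>x \<in> X; y \<in> X\<rbrakk> \<Longrightarrow> x + y \<in> X"
  "\<lbrakk>x \<in> X; y \<in> X\<rbrakk> \<Longrightarrow> x - y \<in> X"
  "x \<in> X \<Longrightarrow> c *\<^sub>R x \<in> X"
  "x \<in> X \<Longrightarrow> - x \<in> X"
  using subspace by (auto simp: subspace_0 subspace_add subspace_diff subspace_scale subspace_neg)

lemma add_right: "\<lbrakk>x \<in> X; y \<in> X; z \<in> X\<rbrakk> \<Longrightarrow> s z (x + y) = s z x + s z y"
  by (simp add: add_left commute [of z])

lemma scale_right: "\<lbrakk>x \<in> X; z \<in> X\<rbrakk> \<Longrightarrow> s z (c *\<^sub>R x) = c * s z x"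
  by (simp add: scale_left commute [of z])

lemma diff_left: "\<lbrakk>x \<in> X; y \<in> X; z \<in> X\<rbrakk> \<Longrightarrow> s (x - y) z = s x z - s y z"
  using add_left [of x "(-1) *\<^sub>R y" z] scale_left [of y z "-1"] mem(4) [of y "-1"] by simp

lemma diff_right: "\<lbrakk>x \<in> X; y \<in> X; z \<in> X\<rbrakk> \<Longrightarrow> s z (x - y) = s z x - s z y"
  by (simp add: diff_left commute [of z])

lemmas bilinear = add_left scale_left add_right scale_right diff_left diff_right

lemma zero_left: "x \<in> X \<Longrightarrow> s 0 x = 0"
  using scale_left [of 0 x 0] by simp

lemma zero_right: "x \<in> X \<Longrightarrow> s x 0 = 0"
  by (simp add: commute [of x] zero_left)

lemma eqI:
  assumes "x \<in> X" "y \<in> X" "\<And>z. z \<in> X \<Longrightarrow> s x z = s y z"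
  shows "x = y"
proof -
  have "s (x - y) (x - y) = 0"
    using assms by (simp add: diff_left)
  then show ?thesis using definite [of "x - y"] assms by simp
qed

lemma sq_add_scale:
  assumes "x \<in> X" "y \<in> X"
  shows "s (x + c *\<^sub>R y) (x + c *\<^sub>R y) = s x x + 2 * c * s x y + c\<^sup>2 * s y y"
  using assms by (simp add: bilinear commute [of y x] power2_eq_square algebra_simps)

lemma Cauchy_Schwarz:
  assumes "x \<in> X" "y \<in> X"
  shows "(s x y)\<^sup>2 \<le> s x x * s y y"
proof (cases "s y y = 0")
  case True
  then have "y = 0" using definite assms by blast
  then show ?thesis using assms by (simp add: zero_right)
next
  case False
  \<comment> \<open>The minimizer of the quadratic
    \<open>s (x + c *\<^sub>R y) (x + c *\<^sub>R y)\<close> in \<open>c\<close>.\<close>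
  define c where "c = - (s x y / s y y)"
  have "0 \<le> s (x + c *\<^sub>R y) (x + c *\<^sub>R y)"
    using assms nonneg by simp
  also have "\<dots> = s x x - (s x y)\<^sup>2 / s y y"
    unfolding sq_add_scale [OF assms] using False by (simp add: c_def power2_eq_square field_simps)
  finally show ?thesis
    using False nonneg [of y] assms by (simp add: field_simps)
qed

text \<open>Parallelogram law: the two sides differ by the square of \<open>x - y\<close>.\<close>

lemma sq_add_le:
  assumes "x \<in> X" "y \<in> X"
  shows "s (x + y) (x + y) \<le> 2 * s x x + 2 * s y y"
  using sq_add_scale [OF assms, of 1] sq_add_scale [OF assms, of "-1"]
    nonneg [of "x + (-1) *\<^sub>R y"] assms by simp

text \<open>The difference of the two sides is \<open>t\<close> times the square of \<open>z + y /\<^sub>R t\<close>.\<close>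

lemma complete_square_le:
  assumes "z \<in> X" "y \<in> X" "t > 0"
  shows "(1 - 1 / t) * s y y \<le> (t - 1) * s z z + s (y + z) (y + z)"
proof -
  have "0 \<le> t * s (z + (1 / t) *\<^sub>R y) (z + (1 / t) *\<^sub>R y)"
    using assms nonneg by simp
  also have "\<dots> = t * s z z + 2 * s z y + s y y / t"
    using assms by (simp add: sq_add_scale power2_eq_square field_simps)
  finally show ?thesis
    using sq_add_scale [of z y 1] assms by (simp add: add.commute algebra_simps)
qed

end

section \<open>Coercive forms and the Riesz representation\<close>

locale coercive_form = scalar_product +
  fixes K \<sigma> :: real
  assumes complete: "complete X"
    and bounded: "\<lbrakk>x \<in> X; y \<in> X\<rbrakk> \<Longrightarrow> \<bar>s x y\<bar> \<le> K * norm x * norm y"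
    and \<sigma>_pos: "\<sigma> > 0"
    and coercive: "x \<in> X \<Longrightarrow> \<sigma> * (norm x)\<^sup>2 \<le> s x x"
begin

text \<open>The representing vector is the minimizer of the energy \<open>s x x - 2 * f x\<close>: minimizing
  sequences are Cauchy by the parallelogram law.\<close>

lemma riesz:
  assumes f: "f \<in> dual_space X"
  obtains x where "x \<in> X" "\<And>y. y \<in> X \<Longrightarrow> s x y = f y"
proof -
  have "\<exists>L. \<forall>x\<in>X. \<bar>f x\<bar> \<le> L * norm x"
    using f by (simp add: dual_space_def)
  then obtain L where L: "\<And>x. x \<in> X \<Longrightarrow> \<bar>f x\<bar> \<le> L * norm x" by blast
  have f_add: "f (x + y) = f x + f y" if "x \<in> X" "y \<in> X" for x y
    using f that by (auto simp: dual_space_def)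
  have f_scale: "f (c *\<^sub>R x) = c * f x" if "x \<in> X" for c x
    using f that by (auto simp: dual_space_def)
  define J where "J x = s x x - 2 * f x" for x
  have J_ge: "J x \<ge> - (L\<^sup>2 / \<sigma>)" if "x \<in> X" for x
  proof -
    \<comment> \<open>The least value of \<open>\<sigma> * r\<^sup>2 - 2 * L * r\<close> over real
      \<open>r\<close> is \<open>- (L\<^sup>2 / \<sigma>)\<close>, attained at
      \<open>r = L / \<sigma>\<close>.\<close>
    have "0 \<le> \<sigma> * (norm x - L / \<sigma>)\<^sup>2" using \<sigma>_pos by simp
    also have "\<dots> = \<sigma> * (norm x)\<^sup>2 - 2 * (L * norm x) + L\<^sup>2 / \<sigma>"
      using \<sigma>_pos by (simp add: power2_eq_square field_simps)
    finally show ?thesis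
      using coercive [OF that] L [OF that] by (simp add: J_def abs_le_iff)
  qed
  define d where "d = (INF x\<in>X. J x)"
  have bdd: "bdd_below (J ` X)" using J_ge by (auto intro!: bdd_belowI)
  have d_le: "d \<le> J x" if "x \<in> X" for x
    unfolding d_def using bdd that by (rule cINF_lower)
  have "\<exists>x\<in>X. J x < d + e" if "e > 0" for e
    using cINF_less_iff [OF _ bdd, of "d + e"] that mem(1) by (force simp: d_def)
  then have "\<forall>k. \<exists>x. x \<in> X \<and> J x < d + 1 / real (Suc k)"
    by (metis of_nat_0_less_iff zero_less_Suc zero_less_divide_1_iff)
  then obtain u where u: "\<And>k. u k \<in> X" "\<And>k. J (u k) < d + 1 / real (Suc k)"
    by metis
  \<comment> \<open>The linear part of \<open>J\<close> cancels in the parallelogram identity, and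
    the midpoint has energy at least \<open>d\<close>.\<close>
  have para: "\<sigma> * (norm (x - y))\<^sup>2 \<le> 2 * (J x - d) + 2 * (J y - d)" if "x \<in> X" "y \<in> X" for x y
  proof -
    have "s (x - y) (x - y) = 2 * J x + 2 * J y - 4 * J ((1/2) *\<^sub>R (x + y))"
      using that by (simp add: J_def bilinear f_add f_scale commute [of y x] algebra_simps)
    moreover have "d \<le> J ((1/2) *\<^sub>R (x + y))" using that by (intro d_le) auto
    ultimately show ?thesis using coercive [of "x - y"] that by simp
  qed
  have "Cauchy u"
  proof (rule metric_CauchyI)
    fix e :: real assume "e > 0"
    define q where "q = \<sigma> * e\<^sup>2 / 4"
    have "q > 0" using \<sigma>_pos \<open>e > 0\<close> by (simp add: q_def)
    then obtain N where N: "1 / real (Suc N) < q"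
      using nat_approx_posE by blast
    have "dist (u m) (u k) < e" if "m \<ge> N" "k \<ge> N" for m k
    proof -
      have small: "J (u j) - d < q" if "j \<ge> N" for j
      proof -
        have "1 / real (Suc j) \<le> 1 / real (Suc N)" using that by (simp add: frac_le)
        then show ?thesis using u(2) [of j] N by linarith
      qed
      have "\<sigma> * (norm (u m - u k))\<^sup>2 < 4 * q"
        using para [OF u(1) [of m] u(1) [of k]] small [OF that(1)] small [OF that(2)]
        by argo
      then have "\<sigma> * (norm (u m - u k))\<^sup>2 < \<sigma> * e\<^sup>2" by (simp add: q_def)
      then have "(norm (u m - u k))\<^sup>2 < e\<^sup>2" using \<sigma>_pos by simp
      then show ?thesis using \<open>e > 0\<close> by (simp add: dist_norm power_less_imp_less_base)
    qed
    then show "\<exists>M. \<forall>m\<ge>M. \<forall>n\<ge>M. dist (u m) (u n) < e" by blast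
  qed
  then obtain x where x: "x \<in> X" "u \<longlonglongrightarrow> x"
    using complete u(1) by (meson complete_def)
  have "s x y = f y" if y: "y \<in> X" for y
  proof -
    have "(s (u k) y - f y)\<^sup>2 \<le> (1 / real (Suc k)) * (s y y + 1)" for k
    proof -
      define a where "a = s (u k) y - f y"
      \<comment> \<open>A step from \<open>u k\<close> along \<open>y\<close> cannot bring the
        energy below \<open>d\<close>, which bounds the residual \<open>a\<close>. The added 1 keeps
        the divisor positive for \<open>y = 0\<close>; \<open>t\<close> minimizes
        \<open>2 * t * a + t\<^sup>2 * r\<close>.\<close>
      define r where "r = s y y + 1"
      define t where "t = - (a / r)"
      have r: "r > 0" "s y y \<le> r" using nonneg [OF y] by (simp_all add: r_def)
      have "d \<le> J (u k + t *\<^sub>R y)" using u(1) y by (intro d_le) auto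
      also have "\<dots> = J (u k) + 2 * t * a + t\<^sup>2 * s y y"
        using u(1) y by (simp add: J_def sq_add_scale f_add f_scale a_def algebra_simps)
      also have "\<dots> \<le> J (u k) + 2 * t * a + t\<^sup>2 * r"
        using r(2) by (simp add: mult_left_mono)
      also have "\<dots> = J (u k) - a\<^sup>2 / r"
        using r(1) by (simp add: t_def power2_eq_square field_simps)
      finally have "a\<^sup>2 / r \<le> 1 / real (Suc k)" using u(2) [of k] by linarith
      then show ?thesis using r(1) unfolding a_def r_def by (simp only: pos_divide_le_eq)
    qed
    then have "\<forall>\<^sub>F k in sequentially. norm ((s (u k) y - f y)\<^sup>2) \<le> (1 / real (Suc k)) * (s y y + 1)"
      by (intro always_eventually allI) simp
    moreover have "(\<lambda>k. (1 / real (Suc k)) * (s y y + 1)) \<longlonglongrightarrow> 0"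
      using tendsto_mult_right [OF LIMSEQ_Suc [OF lim_1_over_n [where 'a = real]], of "s y y + 1"]
      by simp
    ultimately have "(\<lambda>k. (s (u k) y - f y)\<^sup>2) \<longlonglongrightarrow> 0"
      by (rule Lim_null_comparison)
    then have "(\<lambda>k. s (u k) y - f y) \<longlonglongrightarrow> 0" by simp
    moreover have "(\<lambda>k. s (u k) y - f y) \<longlonglongrightarrow> s x y - f y"
    proof -
      have "(\<lambda>k. K * norm (u k - x) * norm y) \<longlonglongrightarrow> K * 0 * norm y"
        using x(2) by (intro tendsto_intros tendsto_norm_zero) (simp add: LIM_zero)
      then have "(\<lambda>k. s (u k - x) y) \<longlonglongrightarrow> 0"
        by (intro Lim_null_comparison [of "\<lambda>k. s (u k - x) y" "\<lambda>k. K * norm (u k - x) * norm y"])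
          (use bounded u(1) x(1) y in \<open>auto intro!: always_eventually\<close>)
      then have "(\<lambda>k. s (u k) y - s x y) \<longlonglongrightarrow> 0"
        using u(1) x(1) y by (simp add: diff_left)
      then have "(\<lambda>k. s (u k) y) \<longlonglongrightarrow> s x y" by (rule LIM_zero_cancel)
      then show ?thesis by (intro tendsto_intros)
    qed
    ultimately have "s x y - f y = 0" using LIMSEQ_unique by blast
    then show ?thesis by simp
  qed
  then show ?thesis using x(1) that by blast
qed

text \<open>The representing vector reproduces \<open>f\<close> on \<open>X\<close>; extensionality
  turns this into equality of functions, so \<open>f\<close> lies in the image of \<open>s\<close>
  and \<open>inv_into\<close> returns a true preimage.\<close>

lemma inv_into_dual:
  assumes f: "f \<in> dual_space X" and ext: "\<forall>x\<in>X. s x \<in> extensional X"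
  shows "inv_into X s f \<in> X" and "y \<in> X \<Longrightarrow> s (inv_into X s f) y = f y"
proof -
  obtain x where x: "x \<in> X" "\<And>y. y \<in> X \<Longrightarrow> s x y = f y" using riesz [OF f] by blast
  have "f \<in> extensional X" using f by (simp add: dual_space_def)
  then have "s x = f" using x ext by (intro extensionalityI [of _ X]) auto
  then have *: "f \<in> s ` X" using x by blast
  show "inv_into X s f \<in> X" using * by (rule inv_into_into)
  show "y \<in> X \<Longrightarrow> s (inv_into X s f) y = f y" using f_inv_into_f [OF *] by simp
qed

end


subsection \<open>Block operators built from a chain of contractions\<close>

text \<open>\<open>\<kappa>\<close> alternates between \<open>(1 - sin \<phi>) / cos \<phi>\<close> and its inverse, and \<open>sin ((k + 1) * \<phi>)\<close> solves
  the three-term recurrence with coefficient \<open>2 * cos \<phi>\<close>.\<close>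

lemma riccati_solution:
  fixes \<phi> e :: real and n :: nat
  assumes e: "e = 1 \<or> e = -1" and \<phi>: "\<phi> > 0" "(2 * real n + 1) * \<phi> \<le> pi / 2"
  defines "\<kappa> \<equiv> \<lambda>k. (1 - (-1) ^ k * e * sin \<phi>) / cos \<phi>"
  defines "t \<equiv> \<lambda>k. \<kappa> k * sin (real (k + 2) * \<phi>) / sin (real (k + 1) * \<phi>)"
  shows "n > 0 \<Longrightarrow> t 0 = 2 - 2 * e * sin \<phi>"
    and "Suc k < n \<Longrightarrow> t (Suc k) = 2 - (-1) ^ Suc k * (2 * e * sin \<phi>) - 1 / t k"
    and "k < n \<Longrightarrow> t k \<ge> 1"
proof -
  have angle: "real j * \<phi> < pi / 2" if "real j < 2 * real n + 1" for j
  proof -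
    have "real j * \<phi> < (2 * real n + 1) * \<phi>" using that \<phi>(1) by simp
    then show ?thesis using \<phi>(2) by linarith
  qed
  have sin_pos: "sin (real j * \<phi>) > 0" if "0 < j" "j \<le> 2 * n" for j
    using that \<phi>(1) angle [of j] pi_gt_zero by (intro sin_gt_zero) (simp, linarith)
  have cos_pos: "cos \<phi> > 0" if "n > 0"
    using angle [of 1] \<phi>(1) that by (intro cos_gt_zero) auto
  have sgn: "(-1) ^ k * e = 1 \<or> (-1) ^ k * e = -1" for k :: nat
    using e by (cases "even k") auto
  show "t 0 = 2 - 2 * e * sin \<phi>" if "n > 0"
  proof -
    have "sin \<phi> > 0" using sin_pos [of 1] that by simp
    then show ?thesis
      using cos_pos [OF that] sin_double [of \<phi>] by (simp add: t_def \<kappa>_def field_simps)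
  qed
  show "t (Suc k) = 2 - (-1) ^ Suc k * (2 * e * sin \<phi>) - 1 / t k" if k: "Suc k < n"
  proof -
    define \<epsilon> where "\<epsilon> = (-1) ^ k * e"
    have \<epsilon>: "\<epsilon> * \<epsilon> = 1" using sgn [of k] unfolding \<epsilon>_def by auto
    have "sin \<phi> < 1"
      using sin_monotone_2pi [of \<phi> "pi/2"] angle [of 1] \<phi>(1) k by simp
    moreover have "sin \<phi> > 0" using sin_pos [of 1] k by simp
    ultimately have ne: "1 - \<epsilon> * sin \<phi> > 0"
      using sgn [of k] unfolding \<epsilon>_def by auto
    have c: "cos \<phi> > 0" using cos_pos k by simp
    \<comment> \<open>The product is \<open>cos \<phi> * cos \<phi>\<close>, so the reciprocal of
      \<open>\<kappa> k\<close> carries the opposite sign and equals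
      \<open>\<kappa> (Suc k)\<close>.\<close>
    have "(1 - \<epsilon> * sin \<phi>) * (1 + \<epsilon> * sin \<phi>) = 1 - (\<epsilon> * \<epsilon>) * (sin \<phi> * sin \<phi>)"
      by (simp add: algebra_simps)
    also have "\<dots> = cos \<phi> * cos \<phi>"
      using sin_cos_squared_add [of \<phi>] by (simp add: \<epsilon> power2_eq_square algebra_simps)
    finally have inv: "1 / ((1 - \<epsilon> * sin \<phi>) / cos \<phi>) = (1 + \<epsilon> * sin \<phi>) / cos \<phi>"
      using ne c by (simp add: field_simps)
    have s1: "sin (real (k + 1) * \<phi>) > 0" and s2: "sin (real (k + 2) * \<phi>) > 0"
      using sin_pos [of "k + 1"] sin_pos [of "k + 2"] k by simp_all
    have "1 / t k = (1 + \<epsilon> * sin \<phi>) / cos \<phi> * (sin (real (k + 1) * \<phi>) / sin (real (k + 2) * \<phi>))"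
      unfolding inv [symmetric] using s1 s2 by (simp add: t_def \<kappa>_def \<epsilon>_def)
    moreover have "t (Suc k) = (1 + \<epsilon> * sin \<phi>) / cos \<phi> * (sin (real (k + 3) * \<phi>) / sin (real (k + 2) * \<phi>))"
      by (simp add: t_def \<kappa>_def \<epsilon>_def numeral_3_eq_3)
    moreover have "sin (real (k + 3) * \<phi>) + sin (real (k + 1) * \<phi>) = 2 * cos \<phi> * sin (real (k + 2) * \<phi>)"
    proof -
      have "sin (real (k + 3) * \<phi>) = sin (real (k + 2) * \<phi> + \<phi>)"
        and "sin (real (k + 1) * \<phi>) = sin (real (k + 2) * \<phi> - \<phi>)"
        by (simp_all add: algebra_simps)
      then show ?thesis by (simp add: sin_add sin_diff)
    qed
    ultimately have "t (Suc k) + 1 / t k =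
        (1 + \<epsilon> * sin \<phi>) / cos \<phi> * ((2 * cos \<phi> * sin (real (k + 2) * \<phi>)) / sin (real (k + 2) * \<phi>))"
      by (simp only: distrib_left [symmetric] add_divide_distrib [symmetric])
    also have "\<dots> = 2 + 2 * \<epsilon> * sin \<phi>" using c s2 by (simp add: field_simps)
    finally show ?thesis by (simp add: \<epsilon>_def algebra_simps)
  qed
  show "t k \<ge> 1" if k: "k < n"
  proof -
    have s1: "sin (real (k + 1) * \<phi>) > 0" and s2: "sin (real (k + 2) * \<phi>) > 0"
      using sin_pos [of "k + 1"] sin_pos [of "k + 2"] k by simp_all
    have s0: "sin \<phi> > 0" using sin_pos [of 1] k by simp
    have c: "cos \<phi> > 0" using cos_pos k by simp
    have split: "real (k + 2) * \<phi> = real (k + 1) * \<phi> + \<phi>" by (simp add: algebra_simps)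
    \<comment> \<open>The angles \<open>(k + 1) * \<phi>\<close> and \<open>(k + 2) * \<phi>\<close>
      add up to \<open>(2 * k + 3) * \<phi>\<close>. For the last index \<open>k = n - 1\<close>
      this is exactly \<open>(2 * n + 1) * \<phi>\<close>, which is where \<open>2 * n + 1\<close>
      in the constant comes from.\<close>
    have "sin (real (k + 2) * \<phi>) \<le> sin (pi / 2 - real (k + 1) * \<phi>)"
    proof -
      have "real (2 * k + 3) * \<phi> \<le> (2 * real n + 1) * \<phi>"
        using k \<phi>(1) by (intro mult_right_mono) auto
      then have "real (k + 2) * \<phi> \<le> pi / 2 - real (k + 1) * \<phi>"
        using \<phi>(2) by (simp add: algebra_simps)
      moreover have "0 \<le> real (k + 1) * \<phi>" "0 \<le> real (k + 2) * \<phi>" using \<phi>(1) by simp_all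
      ultimately show ?thesis by (intro sin_monotone_2pi_le) linarith+
    qed
    then have "0 \<le> sin \<phi> * (cos (real (k + 1) * \<phi>) - sin (real (k + 2) * \<phi>))"
      using s0 by (simp add: sin_diff)
    also have "\<dots> = (1 - sin \<phi>) * sin (real (k + 2) * \<phi>) - cos \<phi> * sin (real (k + 1) * \<phi>)"
      unfolding split sin_add by (simp add: algebra_simps)
    finally have "cos \<phi> * sin (real (k + 1) * \<phi>) \<le> (1 - sin \<phi>) * sin (real (k + 2) * \<phi>)"
      by simp
    \<comment> \<open>Since \<open>sin \<phi> > 0\<close>, the sign \<open>(-1) ^ k * e = 1\<close>
      is the less favourable one.\<close>
    also have "\<dots> \<le> (1 - (-1) ^ k * e * sin \<phi>) * sin (real (k + 2) * \<phi>)"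
      using sgn [of k] s0 s2 by (intro mult_right_mono) auto
    finally show ?thesis
      using c s1 by (simp add: t_def \<kappa>_def pos_le_divide_eq)
  qed
qed

text \<open>\<open>R i\<close> stands for \<open>S\<^sub>i\<inverse> B\<^sub>i'\<close> and
  \<open>U i\<close> for \<open>S\<^sub>i\<^sub>+\<^sub>1\<inverse> B\<^sub>i\<close>. The estimates
  rest only on their being adjoint to each other and on \<open>R i\<close> being a
  contraction.\<close>

locale contraction_chain =
  fixes n :: nat
    and X :: "nat \<Rightarrow> 'h::real_inner set"
    and s :: "nat \<Rightarrow> 'h \<Rightarrow> 'h \<Rightarrow> real"
    and R U :: "nat \<Rightarrow> 'h \<Rightarrow> 'h"
  assumes n_pos: "0 < n"
    and scalar_product: "i < n \<Longrightarrow> scalar_product (X i) (s i)"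
    and R_mem: "\<lbrakk>Suc i < n; y \<in> X (Suc i)\<rbrakk> \<Longrightarrow> R i y \<in> X i"
    and U_mem: "\<lbrakk>Suc i < n; x \<in> X i\<rbrakk> \<Longrightarrow> U i x \<in> X (Suc i)"
    and adjoint: "\<lbrakk>Suc i < n; x \<in> X i; y \<in> X (Suc i)\<rbrakk> \<Longrightarrow> s i (R i y) x = s (Suc i) y (U i x)"
    and R_le: "\<lbrakk>Suc i < n; y \<in> X (Suc i)\<rbrakk> \<Longrightarrow> s i (R i y) (R i y) \<le> s (Suc i) y y"
begin

text \<open>By adjointness and Cauchy-Schwarz, the square of
  \<open>s (Suc i) (U i x) (U i x)\<close> is at most that quantity times \<open>s i x x\<close>;
  one factor cancels.\<close>

lemma U_le:
  assumes i: "Suc i < n" and x: "x \<in> X i"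
  shows "s (Suc i) (U i x) (U i x) \<le> s i x x"
proof -
  interpret a: scalar_product "X i" "s i" using scalar_product i by simp
  interpret b: scalar_product "X (Suc i)" "s (Suc i)" using scalar_product i by simp
  let ?a = "s (Suc i) (U i x) (U i x)"
  have m: "U i x \<in> X (Suc i)" "R i (U i x) \<in> X i" using R_mem U_mem i x by auto
  have "?a\<^sup>2 = (s i (R i (U i x)) x)\<^sup>2" using adjoint i x m by simp
  also have "\<dots> \<le> s i (R i (U i x)) (R i (U i x)) * s i x x"
    using m x by (intro a.Cauchy_Schwarz)
  also have "\<dots> \<le> ?a * s i x x"
    using R_le [OF i m(1)] a.nonneg [OF x] by (intro mult_right_mono)
  finally have "?a * ?a \<le> ?a * s i x x" by (simp add: power2_eq_square)
  then show ?thesis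
    using a.nonneg [OF x] b.nonneg [OF m(1)] by (cases "?a = 0") auto
qed

text \<open>Linearity is forced by the adjoint relation: paired with any element of
  \<open>X i\<close>, both sides move to \<open>U i\<close> and agree there.\<close>

lemma R_comb:
  assumes i: "Suc i < n" and "x \<in> X (Suc i)" "y \<in> X (Suc i)"
  shows "R i (x + c *\<^sub>R y) = R i x + c *\<^sub>R R i y"
proof -
  interpret a: scalar_product "X i" "s i" using scalar_product i by simp
  interpret b: scalar_product "X (Suc i)" "s (Suc i)" using scalar_product i by simp
  show ?thesis
    using assms by (intro a.eqI) (simp_all add: R_mem U_mem a.bilinear b.bilinear adjoint)
qed

lemma U_comb:
  assumes i: "Suc i < n" and "x \<in> X i" "y \<in> X i"
  shows "U i (x + c *\<^sub>R y) = U i x + c *\<^sub>R U i y"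
proof -
  interpret a: scalar_product "X i" "s i" using scalar_product i by simp
  interpret b: scalar_product "X (Suc i)" "s (Suc i)" using scalar_product i by simp
  have "s (Suc i) (U i x') z = s i x' (R i z)" if "x' \<in> X i" "z \<in> X (Suc i)" for x' z
    using that i R_mem U_mem by (metis a.commute adjoint b.commute)
  then show ?thesis
    using assms by (intro b.eqI) (simp_all add: R_mem U_mem a.bilinear b.bilinear)
qed

section \<open>The product space and the factors of the block operator\<close>

abbreviation "P \<equiv> prod_space n X"

definition ip :: "(nat \<Rightarrow> 'h) \<Rightarrow> (nat \<Rightarrow> 'h) \<Rightarrow> real" where
  "ip x y = (\<Sum>i<n. s i (x i) (y i))"

text \<open>One operation for sums, differences and multiples of tuples; the restriction keeps the
  result in the extensional product \<open>P\<close>.\<close>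

definition comb :: "(nat \<Rightarrow> 'h) \<Rightarrow> real \<Rightarrow> (nat \<Rightarrow> 'h) \<Rightarrow> nat \<Rightarrow> 'h" where
  "comb x c y = (\<lambda>i\<in>{..<n}. x i + c *\<^sub>R y i)"

text \<open>With the signs \<open>D = diag ((-1) ^ i)\<close> and the unit lower bidiagonal \<open>L\<close> whose subdiagonal is
  \<open>(-1) ^ i * U i\<close>, \<open>upper\<close> is the adjoint of \<open>L\<close>, \<open>lower\<close> is \<open>L D\<close>, and \<open>op = L D L'\<close>.\<close>

definition upper :: "(nat \<Rightarrow> 'h) \<Rightarrow> nat \<Rightarrow> 'h" where
  "upper x i = x i + (if Suc i < n then (-1) ^ i *\<^sub>R R i (x (Suc i)) else 0)"

definition lower :: "(nat \<Rightarrow> 'h) \<Rightarrow> nat \<Rightarrow> 'h" where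
  "lower g i = (-1) ^ i *\<^sub>R g i + (case i of 0 \<Rightarrow> 0 | Suc j \<Rightarrow> U j (g j))"

definition op :: "(nat \<Rightarrow> 'h) \<Rightarrow> nat \<Rightarrow> 'h" where
  "op x = (\<lambda>i\<in>{..<n}. lower (upper x) i)"

lemma prod_spaceD: "x \<in> P \<Longrightarrow> i < n \<Longrightarrow> x i \<in> X i"
  by (auto simp: prod_space_def)

lemma zero_mem: "i < n \<Longrightarrow> 0 \<in> X i"
  using scalar_product scalar_product.mem(1) by blast

lemma comb_mem_component:
  "\<lbrakk>i < n; x \<in> X i; y \<in> X i\<rbrakk> \<Longrightarrow> x + c *\<^sub>R y \<in> X i"
  using scalar_product scalar_product.mem(2,4) by blast

lemma scale_mem_component: "\<lbrakk>i < n; x \<in> X i\<rbrakk> \<Longrightarrow> c *\<^sub>R x \<in> X i"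
  using scalar_product scalar_product.mem(4) by blast

lemma comb_mem: "\<lbrakk>x \<in> P; y \<in> P\<rbrakk> \<Longrightarrow> comb x c y \<in> P"
  by (auto simp: prod_space_def comb_def PiE_iff intro!: comb_mem_component)

lemma upper_mem: "\<lbrakk>x \<in> P; i < n\<rbrakk> \<Longrightarrow> upper x i \<in> X i"
  by (auto simp: upper_def prod_spaceD R_mem intro!: comb_mem_component)

lemma lower_mem: "\<lbrakk>\<And>i. i < n \<Longrightarrow> g i \<in> X i; i < n\<rbrakk> \<Longrightarrow> lower g i \<in> X i"
  using comb_mem_component [of i "(-1) ^ i *\<^sub>R g i" _ 1]
  by (cases i) (auto simp: lower_def scale_mem_component U_mem simp del: power_Suc)

lemma op_mem: "x \<in> P \<Longrightarrow> op x \<in> P"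
  using lower_mem [OF upper_mem] by (simp add: op_def prod_space_def restrict_PiE_iff)

lemma upper_comb:
  assumes "x \<in> P" "y \<in> P" "i < n"
  shows "upper (comb x c y) i = upper x i + c *\<^sub>R upper y i"
  using assms
  by (simp add: upper_def comb_def prod_spaceD R_comb algebra_simps)

lemma op_comb:
  assumes "x \<in> P" "y \<in> P"
  shows "op (comb x c y) = comb (op x) c (op y)"
proof
  fix i
  show "op (comb x c y) i = comb (op x) c (op y) i"
    using assms
    by (cases i) (auto simp: op_def lower_def upper_comb upper_mem U_comb algebra_simps comb_def [of "restrict _ _"])
qed

lemma ip_nonneg: "x \<in> P \<Longrightarrow> 0 \<le> ip x x"
  unfolding ip_def using scalar_product.nonneg [OF scalar_product]
  by (intro sum_nonneg) (auto simp: prod_spaceD)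

lemma ip_commute: "\<lbrakk>x \<in> P; y \<in> P\<rbrakk> \<Longrightarrow> ip x y = ip y x"
  unfolding ip_def using scalar_product.commute [OF scalar_product]
  by (intro sum.cong) (auto simp: prod_spaceD)

lemma ip_comb:
  assumes "x \<in> P" "y \<in> P" "v \<in> P" "w \<in> P"
  shows "ip (comb x c v) (comb y c w) = ip x y + c * ip x w + c * ip v y + c\<^sup>2 * ip v w"
proof -
  have "s i (x i + c *\<^sub>R v i) (y i + c *\<^sub>R w i) =
      s i (x i) (y i) + c * s i (x i) (w i) + c * s i (v i) (y i) + c\<^sup>2 * s i (v i) (w i)"
    if i: "i < n" for i
  proof -
    interpret scalar_product "X i" "s i" using scalar_product i .
    show ?thesis using assms i
      by (simp add: bilinear prod_spaceD power2_eq_square algebra_simps)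
  qed
  then show ?thesis
    unfolding ip_def comb_def by (simp add: sum.distrib sum_distrib_left)
qed

lemma ip_definite: "\<lbrakk>x \<in> P; y \<in> P; ip (comb x (-1) y) (comb x (-1) y) = 0\<rbrakk> \<Longrightarrow> x = y"
proof -
  assume x: "x \<in> P" and y: "y \<in> P" and z: "ip (comb x (-1) y) (comb x (-1) y) = 0"
  have "\<forall>i<n. s i (x i - y i) (x i - y i) = 0"
    using z scalar_product.nonneg [OF scalar_product] x y
      scalar_product.mem(3) [OF scalar_product]
    by (subst (asm) ip_def, subst (asm) sum_nonneg_eq_0_iff) (auto simp: comb_def prod_spaceD)
  then have "\<forall>i<n. x i = y i"
    using scalar_product.definite [OF scalar_product] scalar_product.mem(3) [OF scalar_product] x y
    by (metis eq_iff_diff_eq_0 prod_spaceD)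
  then show "x = y"
    using x y unfolding prod_space_def by (intro PiE_ext [of x "{..<n}" X y]) auto
qed

text \<open>The factor \<open>L\<close> moves to the second argument, where it becomes its adjoint
  \<open>upper\<close>. The result gives both the symmetry of \<open>op\<close> and its quadratic
  form.\<close>

lemma ip_op:
  assumes x: "x \<in> P" and y: "y \<in> P"
  shows "ip (op x) y = (\<Sum>i<n. (-1) ^ i * s i (upper x i) (upper y i))"
proof -
  obtain m where n: "n = Suc m" using n_pos by (cases n) auto
  define g where "g = upper x"
  have g: "g i \<in> X i" if "i < n" for i using upper_mem x that by (simp add: g_def)
  have y': "y i \<in> X i" if "i < n" for i using prod_spaceD y that by simp
  have "ip (op x) y = (\<Sum>i<n. s i (lower g i) (y i))"
    by (simp add: ip_def op_def g_def)
  also have "\<dots> = s 0 (g 0) (y 0) +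
      (\<Sum>i<m. (-1) ^ Suc i * s (Suc i) (g (Suc i)) (y (Suc i)) + s (Suc i) (U i (g i)) (y (Suc i)))"
  proof -
    have "s (Suc i) (lower g (Suc i)) (y (Suc i)) =
       (-1) ^ Suc i * s (Suc i) (g (Suc i)) (y (Suc i)) + s (Suc i) (U i (g i)) (y (Suc i))"
      if "i < m" for i
    proof -
      have i: "Suc i < n" using that n by simp
      interpret scalar_product "X (Suc i)" "s (Suc i)" using scalar_product i .
      show ?thesis using g [OF i] y' [OF i] U_mem [OF i g] i
        unfolding lower_def by (simp add: bilinear del: power_Suc)
    qed
    moreover have "lower g 0 = g 0" by (simp add: lower_def)
    ultimately show ?thesis
      unfolding n sum.lessThan_Suc_shift by simp
  qed
  \<comment> \<open>The adjoint relation turns the subdiagonal term of row \<open>Suc i\<close> into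
    a superdiagonal term of row \<open>i\<close>.\<close>
  also have "\<dots> = (\<Sum>i<n. (-1) ^ i * s i (g i) (y i)) + (\<Sum>i<m. s i (g i) (R i (y (Suc i))))"
  proof -
    have "s (Suc i) (U i (g i)) (y (Suc i)) = s i (g i) (R i (y (Suc i)))" if "i < m" for i
    proof -
      have i: "Suc i < n" using that n by simp
      interpret a: scalar_product "X i" "s i" using scalar_product i by simp
      interpret b: scalar_product "X (Suc i)" "s (Suc i)" using scalar_product i .
      show ?thesis
        using i g y' R_mem U_mem by (metis Suc_lessD a.commute adjoint b.commute)
    qed
    then show ?thesis
      unfolding n sum.lessThan_Suc_shift by (simp add: sum.distrib del: power_Suc)
  qed
  also have "\<dots> = (\<Sum>i<n. (-1) ^ i * s i (g i) (upper y i))"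
  proof -
    have "(-1) ^ i * s i (g i) (upper y i) = (-1) ^ i * s i (g i) (y i) + s i (g i) (R i (y (Suc i)))"
      if "i < m" for i
    proof -
      have i: "Suc i < n" using that n by simp
      interpret scalar_product "X i" "s i" using scalar_product i by simp
      have "(-1) ^ i * ((-1) ^ i * a) = a" for a :: real
        by (simp flip: mult.assoc power_mult_distrib)
      then show ?thesis using i g y' R_mem
        unfolding upper_def by (simp add: bilinear distrib_left)
    qed
    moreover have "upper y m = y m" unfolding upper_def by (simp add: n)
    ultimately show ?thesis unfolding n sum.lessThan_Suc by (simp add: sum.distrib)
  qed
  finally show ?thesis by (simp add: g_def)
qed

lemma op_symmetric:
  assumes "x \<in> P" "y \<in> P"
  shows "ip (op x) y = ip x (op y)"
proof -
  have "ip (op x) y = ip (op y) x"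
    unfolding ip_op [OF assms] ip_op [OF assms(2,1)]
    using scalar_product.commute [OF scalar_product] assms
    by (intro sum.cong) (auto simp: upper_mem)
  then show ?thesis using assms by (simp add: ip_commute op_mem)
qed

section \<open>Solving with the triangular factors\<close>

text \<open>Forward substitution from block \<open>0\<close>, where the diagonal entries are signs
  and hence their own inverses.\<close>

lemma lower_surj:
  assumes f: "\<And>i. i < n \<Longrightarrow> f i \<in> X i"
  obtains g where "\<And>i. i < n \<Longrightarrow> g i \<in> X i" "\<And>i. i < n \<Longrightarrow> lower g i = f i"
proof -
  define g where "g = rec_nat (f 0) (\<lambda>j gj. (-1) ^ Suc j *\<^sub>R (f (Suc j) - U j gj))"
  have g0: "g 0 = f 0" and gS: "g (Suc j) = (-1) ^ Suc j *\<^sub>R (f (Suc j) - U j (g j))" for j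
    by (simp_all add: g_def)
  have mem: "g i \<in> X i" if "i < n" for i
    using that
  proof (induction i)
    case 0
    then show ?case by (simp add: g0 f)
  next
    case (Suc i)
    interpret scalar_product "X (Suc i)" "s (Suc i)" using scalar_product Suc.prems .
    show ?case unfolding gS using Suc by (intro mem) (auto simp: f U_mem)
  qed
  have "lower g i = f i" for i
    by (cases i) (simp_all add: lower_def g0 gS flip: power_mult_distrib)
  then show ?thesis using mem that by blast
qed

text \<open>Back substitution from the last block; the induction is on the number \<open>k\<close>
  of trailing blocks already solved.\<close>

lemma upper_surj:
  assumes g: "\<And>i. i < n \<Longrightarrow> g i \<in> X i"
  obtains x where "x \<in> P" "\<And>i. i < n \<Longrightarrow> upper x i = g i"
proof -
  have "\<exists>x. \<forall>i. n - k \<le> i \<and> i < n \<longrightarrow> x i \<in> X i \<and> upper x i = g i" if "k \<le> n" for k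
    using that
  proof (induction k)
    case 0
    show ?case by auto
  next
    case (Suc k)
    then obtain x where x: "\<And>i. n - k \<le> i \<Longrightarrow> i < n \<Longrightarrow> x i \<in> X i \<and> upper x i = g i" by auto
    define j where "j = n - Suc k"
    have j: "j < n" "n - k = Suc j" using Suc.prems by (auto simp: j_def)
    interpret scalar_product "X j" "s j" using scalar_product j(1) .
    define z where "z = g j - (if Suc j < n then (-1) ^ j *\<^sub>R R j (x (Suc j)) else 0)"
    have "R j (x (Suc j)) \<in> X j" if "Suc j < n"
      using R_mem [OF that] x [of "Suc j"] j(2) that by simp
    then have z: "z \<in> X j" unfolding z_def using g [OF j(1)] by simp
    have "(x(j := z)) i \<in> X i \<and> upper (x(j := z)) i = g i" if "j \<le> i" "i < n" for i
    proof (cases "i = j")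
      case True
      have "upper (x(j := z)) j = g j" by (simp add: upper_def z_def)
      then show ?thesis using z True by simp
    next
      case False
      then have "upper (x(j := z)) i = upper x i" using that by (simp add: upper_def)
      then show ?thesis using x [of i] False that j(2) by simp
    qed
    then show ?case unfolding j_def [symmetric] by blast
  qed
  from this [of n] obtain x where x: "\<And>i. i < n \<Longrightarrow> x i \<in> X i \<and> upper x i = g i" by auto
  have "restrict x {..<n} \<in> P" using x by (simp add: prod_space_def)
  moreover have "upper (restrict x {..<n}) i = g i" if "i < n" for i
    using x [OF that] that by (simp add: upper_def split: if_splits)
  ultimately show ?thesis using that by blast
qed

lemma op_surj:
  assumes f: "f \<in> P"
  obtains x where "x \<in> P" "op x = f"
proof -
  obtain g where g: "\<And>i. i < n \<Longrightarrow> g i \<in> X i" "\<And>i. i < n \<Longrightarrow> lower g i = f i"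
    using lower_surj [of f] f prod_spaceD by blast
  obtain x where x: "x \<in> P" "\<And>i. i < n \<Longrightarrow> upper x i = g i"
    using upper_surj [of g] g(1) by blast
  have "op x i = f i" for i
  proof (cases "i < n")
    case True
    then have "lower (upper x) i = lower g i"
      using x(2) by (cases i) (simp_all add: lower_def)
    then show ?thesis using True g(2) by (simp add: op_def)
  next
    case False
    then show ?thesis using f by (auto simp: op_def prod_space_def PiE_def extensional_def)
  qed
  then show ?thesis using x(1) that by blast
qed

section \<open>The energy estimate and its constant\<close>

text \<open>The left-hand side is the reserve left after the blocks up to \<open>k\<close>. The next
  block spends it on completing the square with parameter \<open>t k\<close>; what remains has the
  coefficient \<open>1 - 1 / t k - (-1) ^ Suc k * \<mu> = t (Suc k) - 1\<close>.\<close>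

lemma partial_energy:
  assumes g: "\<And>i. i < n \<Longrightarrow> g i \<in> X i"
    and t0: "t 0 = 2 - \<mu>"
    and tS: "\<And>k. Suc k < n \<Longrightarrow> t (Suc k) = 2 - (-1) ^ Suc k * \<mu> - 1 / t k"
    and t1: "\<And>k. k < n \<Longrightarrow> t k \<ge> 1"
    and k: "k < n"
  shows "(t k - 1) * s k (g k) (g k) \<le>
    (\<Sum>i<Suc k. s i (lower g i) (lower g i) - \<mu> * ((-1) ^ i * s i (g i) (g i)))"
  using k
proof (induction k)
  case 0
  then show ?case by (simp add: lower_def t0 algebra_simps)
next
  case (Suc k)
  then have i: "Suc k < n" and k: "k < n" by simp_all
  interpret scalar_product "X (Suc k)" "s (Suc k)" using scalar_product i .
  let ?b = "(-1) ^ Suc k *\<^sub>R g (Suc k)" and ?c = "U k (g k)"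
  have m: "?b \<in> X (Suc k)" "?c \<in> X (Suc k)" using g [OF i] U_mem [OF i g [OF k]] by auto
  have "(-1) ^ Suc k * ((-1) ^ Suc k * a) = a" for a :: real
    by (simp flip: mult.assoc power_mult_distrib)
  then have b: "s (Suc k) ?b ?b = s (Suc k) (g (Suc k)) (g (Suc k))"
    using g [OF i] by (simp only: scale_left scale_right mem)
  have "(1 - 1 / t k) * s (Suc k) ?b ?b \<le> (t k - 1) * s (Suc k) ?c ?c + s (Suc k) (?b + ?c) (?b + ?c)"
    using m t1 [OF k] by (intro complete_square_le) auto
  \<comment> \<open>As \<open>t k - 1\<close> is nonnegative, the contraction \<open>U k\<close>
    lets the reserve at \<open>g k\<close> pay for the term at \<open>U k (g k)\<close>.\<close>
  also have "\<dots> \<le> (t k - 1) * s k (g k) (g k) + s (Suc k) (?b + ?c) (?b + ?c)"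
    using U_le [OF i g [OF k]] t1 [OF k] by (intro add_right_mono mult_left_mono) auto
  also have "?b + ?c = lower g (Suc k)" by (simp add: lower_def)
  finally show ?case
    using Suc.IH [OF k] unfolding b sum.lessThan_Suc [of _ "Suc k"] tS [OF i]
    by (simp add: algebra_simps)
qed

text \<open>The reciprocal of the bound to be proved.\<close>

definition lam :: real where "lam = 2 * sin (pi / (2 * (2 * real n + 1)))"

lemma lam_pos: "lam > 0"
proof -
  have "pi / (2 * (2 * real n + 1)) < pi / 1"
    by (intro divide_strict_left_mono) auto
  then show ?thesis unfolding lam_def by (simp add: sin_gt_zero)
qed

text \<open>With \<open>f = op x\<close>, \<open>ip x (op x)\<close> is the quadratic form of the
  inverse of \<open>op\<close> at \<open>f\<close>. In terms of \<open>upper x\<close> it is an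
  alternating sum, which \<open>partial_energy\<close> at the last block compares with the square of
  the norm of \<open>f\<close>.\<close>

lemma energy_le:
  assumes x: "x \<in> P"
  shows "lam * \<bar>ip x (op x)\<bar> \<le> ip (op x) (op x)"
proof -
  define g where "g = upper x"
  have g: "g i \<in> X i" if "i < n" for i using upper_mem x that by (simp add: g_def)
  define \<phi> where "\<phi> = pi / (2 * (2 * real n + 1))"
  have \<phi>: "\<phi> > 0" "(2 * real n + 1) * \<phi> \<le> pi / 2"
  proof -
    have "2 * real n + 1 > 0" by simp
    then show "\<phi> > 0" "(2 * real n + 1) * \<phi> \<le> pi / 2" by (simp_all add: \<phi>_def field_simps)
  qed
  have eq: "ip x (op x) = (\<Sum>i<n. (-1) ^ i * s i (g i) (g i))"
    using ip_op [OF x x] x by (simp add: g_def ip_commute op_mem)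
  \<comment> \<open>The sign \<open>e\<close> covers both cases of the absolute value;
    \<open>\<mu>\<close> is \<open>e * lam\<close>.\<close>
  have "e * lam * ip x (op x) \<le> ip (op x) (op x)" if e: "e = 1 \<or> e = -1" for e :: real
  proof -
    define t where "t k = (1 - (-1) ^ k * e * sin \<phi>) / cos \<phi> * sin (real (k + 2) * \<phi>) / sin (real (k + 1) * \<phi>)"
      for k
    note ric = riccati_solution [OF e \<phi>, folded t_def]
    have n1: "n - 1 < n" "Suc (n - 1) = n" using n_pos by simp_all
    have "0 \<le> (t (n - 1) - 1) * s (n - 1) (g (n - 1)) (g (n - 1))"
      using ric(3) [OF n1(1)] scalar_product.nonneg [OF scalar_product [OF n1(1)] g [OF n1(1)]]
      by simp
    also have "\<dots> \<le> (\<Sum>i<n. s i (lower g i) (lower g i) - (2 * e * sin \<phi>) * ((-1) ^ i * s i (g i) (g i)))"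
      using partial_energy [where t = t and \<mu> = "2 * e * sin \<phi>", OF g ric(1) [OF n_pos] ric(2,3) n1(1)]
      unfolding n1(2) by blast
    also have "\<dots> = ip (op x) (op x) - e * lam * ip x (op x)"
      unfolding eq by (simp add: ip_def op_def g_def lam_def \<phi>_def sum_subtractf sum_distrib_left mult_ac)
    finally show ?thesis by simp
  qed
  from this [of 1] this [of "-1"] show ?thesis
    using lam_pos by (auto simp: abs_if)
qed

text \<open>Polarization: \<open>energy_le\<close> bounds the quadratic form of the symmetric inverse of \<open>op\<close>.\<close>

lemma op_bounded_below:
  assumes x: "x \<in> P"
  shows "lam\<^sup>2 * ip x x \<le> ip (op x) (op x)"
proof -
  \<comment> \<open>\<open>v\<close> is the inverse of \<open>op\<close> applied to
    \<open>x\<close>; by symmetry, its pairing with \<open>op x\<close> is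
    \<open>ip x x\<close>.\<close>
  obtain v where v: "v \<in> P" "op v = x" using op_surj [OF x] .
  have vf: "ip v (op x) = ip x x" using op_symmetric [OF v(1) x] v(2) by simp
  have "lam * \<bar>ip (comb x c v) (op (comb x c v))\<bar> \<le> ip (op (comb x c v)) (op (comb x c v))" for c
    using x v by (intro energy_le comb_mem)
  then have *: "lam * \<bar>ip x (op x) + c * ip x x + c * ip x x + c\<^sup>2 * ip v x\<bar> \<le>
      ip (op x) (op x) + c * ip (op x) x + c * ip (op x) x + c\<^sup>2 * ip x x" for c
    using x v op_mem vf ip_commute [OF x op_mem [OF x]] by (simp add: op_comb ip_comb)
  \<comment> \<open>The cases \<open>c = lam\<close> and \<open>c = - lam\<close>, with the absolute
    value resolved in opposite ways, add up to \<open>4 * lam\<^sup>2 * ip x x \<le> 2 * ip (op x)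
    (op x) + 2 * lam\<^sup>2 * ip x x\<close>; all other terms cancel.\<close>
  have "lam * (ip x (op x) + lam * ip x x + lam * ip x x + lam\<^sup>2 * ip v x) \<le>
      ip (op x) (op x) + lam * ip (op x) x + lam * ip (op x) x + lam\<^sup>2 * ip x x"
    by (rule order_trans [OF _ * [of lam]]) (use lam_pos in \<open>intro mult_left_mono, auto\<close>)
  moreover have "lam * - (ip x (op x) - lam * ip x x - lam * ip x x + lam\<^sup>2 * ip v x) \<le>
      ip (op x) (op x) - lam * ip (op x) x - lam * ip (op x) x + lam\<^sup>2 * ip x x"
    by (rule order_trans [OF _ order_trans [OF * [of "- lam"]]]) (use lam_pos in \<open>auto intro!: mult_left_mono\<close>)
  ultimately show ?thesis by (simp add: algebra_simps power2_eq_square)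
qed

text \<open>Each of \<open>upper\<close> and \<open>lower\<close> is a diagonal of signs plus a
  contraction, so it multiplies the square of the norm by at most 4. The crude constant serves only
  to show boundedness.\<close>

lemma op_bounded:
  assumes x: "x \<in> P"
  shows "ip (op x) (op x) \<le> 16 * ip x x"
proof -
  obtain m where n: "n = Suc m" using n_pos by (cases n) auto
  define g where "g = upper x"
  have g: "g i \<in> X i" if "i < n" for i using upper_mem x that by (simp add: g_def)
  have x': "x i \<in> X i" if "i < n" for i using prod_spaceD x that by simp
  have sq: "(-1) ^ i * ((-1) ^ i * a) = a" for a :: real and i :: nat
    by (simp flip: mult.assoc power_mult_distrib)
  have pos: "0 \<le> s i y y" if "i < n" "y \<in> X i" for i y
    using scalar_product.nonneg [OF scalar_product] that by blast
  have "ip (op x) (op x) = (\<Sum>i<n. s i (lower g i) (lower g i))"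
    by (simp add: ip_def op_def g_def)
  also have "\<dots> \<le> 2 * s 0 (g 0) (g 0) + (\<Sum>i<m. 2 * s (Suc i) (g (Suc i)) (g (Suc i)) + 2 * s i (g i) (g i))"
  proof -
    have "s (Suc i) (lower g (Suc i)) (lower g (Suc i)) \<le>
        2 * s (Suc i) (g (Suc i)) (g (Suc i)) + 2 * s i (g i) (g i)" if "i < m" for i
    proof -
      have i: "Suc i < n" using that n by simp
      interpret scalar_product "X (Suc i)" "s (Suc i)" using scalar_product i .
      have "s (Suc i) ((-1) ^ Suc i *\<^sub>R g (Suc i)) ((-1) ^ Suc i *\<^sub>R g (Suc i)) =
          s (Suc i) (g (Suc i)) (g (Suc i))"
        using g [OF i] sq by (simp only: scale_left scale_right mem)
      moreover have "lower g (Suc i) = (-1) ^ Suc i *\<^sub>R g (Suc i) + U i (g i)"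
        by (simp add: lower_def)
      moreover have "s (Suc i) (U i (g i)) (U i (g i)) \<le> s i (g i) (g i)"
        using U_le g i by simp
      ultimately show ?thesis
        using sq_add_le [OF mem(4) [OF g [OF i]] U_mem [OF i g], of "(-1) ^ Suc i"] i by simp
    qed
    moreover have "0 \<le> s 0 (g 0) (g 0)" using g pos n_pos by blast
    ultimately show ?thesis
      unfolding n sum.lessThan_Suc_shift by (intro add_mono sum_mono) (auto simp: lower_def)
  qed
  also have "\<dots> \<le> 4 * (\<Sum>i<n. s i (g i) (g i))"
  proof -
    have "0 \<le> s m (g m) (g m)" using g pos n by blast
    then have "(\<Sum>i<m. s i (g i) (g i)) \<le> (\<Sum>i<n. s i (g i) (g i))" by (simp add: n)
    moreover have "s 0 (g 0) (g 0) + (\<Sum>i<m. s (Suc i) (g (Suc i)) (g (Suc i))) = (\<Sum>i<n. s i (g i) (g i))"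
      unfolding n sum.lessThan_Suc_shift by simp
    ultimately show ?thesis by (simp add: sum.distrib flip: sum_distrib_left)
  qed
  also have "(\<Sum>i<n. s i (g i) (g i)) \<le> (\<Sum>i<m. 2 * s i (x i) (x i) + 2 * s (Suc i) (x (Suc i)) (x (Suc i))) + 2 * s m (x m) (x m)"
  proof -
    have "s i (g i) (g i) \<le> 2 * s i (x i) (x i) + 2 * s (Suc i) (x (Suc i)) (x (Suc i))" if "i < m" for i
    proof -
      have i: "Suc i < n" using that n by simp
      interpret scalar_product "X i" "s i" using scalar_product i by simp
      have r: "R i (x (Suc i)) \<in> X i" using R_mem i x' by blast
      then have "s i ((-1) ^ i *\<^sub>R R i (x (Suc i))) ((-1) ^ i *\<^sub>R R i (x (Suc i))) =
          s i (R i (x (Suc i))) (R i (x (Suc i)))"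
        using sq by (simp only: scale_left scale_right mem)
      moreover have "g i = x i + (-1) ^ i *\<^sub>R R i (x (Suc i))"
        using i by (simp add: g_def upper_def)
      ultimately show ?thesis
        using sq_add_le [OF x' mem(4) [OF r], of "(-1) ^ i"] R_le [OF i x' [OF i]] i by simp
    qed
    moreover have "g m = x m" unfolding g_def upper_def by (simp add: n)
    moreover have "0 \<le> s m (x m) (x m)" using x' pos n by blast
    ultimately show ?thesis
      unfolding n sum.lessThan_Suc by (intro add_mono sum_mono) auto
  qed
  also have "\<dots> \<le> 4 * (\<Sum>i<n. s i (x i) (x i))"
  proof -
    have "0 \<le> s 0 (x 0) (x 0)" using x' pos n by blast
    then have "(\<Sum>i<m. s (Suc i) (x (Suc i)) (x (Suc i))) \<le> (\<Sum>i<n. s i (x i) (x i))"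
      unfolding n sum.lessThan_Suc_shift by simp
    moreover have "(\<Sum>i<m. s i (x i) (x i)) + s m (x m) (x m) = (\<Sum>i<n. s i (x i) (x i))"
      by (simp add: n)
    ultimately show ?thesis by (simp add: sum.distrib flip: sum_distrib_left)
  qed
  finally show ?thesis by (simp add: ip_def)
qed

section \<open>The inverse and its operator norm\<close>

text \<open>Compatibility with \<open>comb\<close> captures linearity: \<open>c = 1\<close> gives
  sums, and the multiple of \<open>x\<close> by \<open>c\<close> is
  \<open>comb x (c - 1) x\<close>.\<close>

lemma bounded_opsI:
  assumes mem: "\<And>x. x \<in> P \<Longrightarrow> T x \<in> P"
    and comb: "\<And>x y c. \<lbrakk>x \<in> P; y \<in> P\<rbrakk> \<Longrightarrow> T (comb x c y) = comb (T x) c (T y)"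
    and bound: "\<And>x. x \<in> P \<Longrightarrow> N (T x) \<le> K * N x"
  shows "T \<in> bounded_ops n X N"
proof -
  have add: "(\<lambda>i\<in>{..<n}. x i + y i) = comb x 1 y" for x y
    by (simp add: comb_def)
  have scale: "(\<lambda>i\<in>{..<n}. c *\<^sub>R x i) = comb x (c - 1) x" for x c
    by (simp add: comb_def algebra_simps)
  show ?thesis
    using assms unfolding bounded_ops_def add scale by blast
qed

text \<open>The lower bound \<open>op_bounded_below\<close> is applied to the difference of
  \<open>x\<close> and \<open>y\<close>.\<close>

lemma op_inj:
  assumes "x \<in> P" "y \<in> P" "op x = op y"
  shows "x = y"
proof -
  have z: "comb x (-1) y \<in> P" using assms by (intro comb_mem)
  have "ip (op (comb x (-1) y)) (op (comb x (-1) y)) = 0"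
    using assms ip_comb [of "op y" "op y" "op y" "op y" "-1"] op_mem [of y] by (simp add: op_comb)
  then have "lam\<^sup>2 * ip (comb x (-1) y) (comb x (-1) y) \<le> 0"
    using op_bounded_below [OF z] by simp
  then have "ip (comb x (-1) y) (comb x (-1) y) = 0"
    using lam_pos ip_nonneg [OF z] by (simp add: mult_le_0_iff order_antisym)
  then show ?thesis using ip_definite assms by blast
qed

text \<open>\<open>N\<close> and \<open>T\<close> are kept general because the Schur norm and the
  preconditioned operator are identified with \<open>sqrt (ip x x)\<close> and \<open>op\<close>
  only on \<open>P\<close>.\<close>

lemma inverse_bounded:
  assumes N: "\<And>x. x \<in> P \<Longrightarrow> N x = sqrt (ip x x)"
    and T: "\<And>x. x \<in> P \<Longrightarrow> T x = op x"
  shows "T \<in> bounded_ops n X N" "bij_betw T P P" "inv_into P T \<in> bounded_ops n X N"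
    "op_norm n X N (inv_into P T) \<le> 1 / lam"
proof -
  have N_op: "N (op x) \<le> 4 * N x" if x: "x \<in> P" for x
    using real_sqrt_le_mono [OF op_bounded [OF x]] N [OF x] N [OF op_mem [OF x]]
    by (simp add: real_sqrt_mult)
  show "T \<in> bounded_ops n X N"
    by (rule bounded_opsI [where K = 4]) (simp_all add: T op_mem comb_mem op_comb N_op)
  show bij: "bij_betw T P P"
  proof (rule bij_betw_imageI)
    show "inj_on T P" using op_inj T by (auto intro: inj_onI)
    show "T ` P = P"
    proof
      show "T ` P \<subseteq> P" using T op_mem by auto
      show "P \<subseteq> T ` P"
      proof
        fix f assume "f \<in> P"
        then obtain x where "x \<in> P" "op x = f" using op_surj by blast
        then show "f \<in> T ` P" using T by force
      qed
    qed
  qed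
  define V where "V = inv_into P T"
  have V_mem: "V f \<in> P" if "f \<in> P" for f
    using bij that unfolding V_def by (metis bij_betw_imp_surj_on inv_into_into)
  have op_V: "op (V f) = f" if "f \<in> P" for f
    using bij that V_mem T unfolding V_def by (metis bij_betw_inv_into_right)
  have V_bound: "N (V f) \<le> 1 / lam * N f" if f: "f \<in> P" for f
  proof -
    have "sqrt (lam\<^sup>2 * ip (V f) (V f)) \<le> sqrt (ip f f)"
      using op_bounded_below [OF V_mem [OF f]] op_V [OF f] by (intro real_sqrt_le_mono) simp
    then have "lam * N (V f) \<le> N f"
      using lam_pos f V_mem by (simp add: real_sqrt_mult N)
    then show ?thesis using lam_pos by (simp add: field_simps)
  qed
  \<comment> \<open>The inverse is linear because both sides have the same image under the injective
    linear \<open>op\<close>.\<close>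
  have V_comb: "V (comb x c y) = comb (V x) c (V y)" if xy: "x \<in> P" "y \<in> P" for x y c
  proof (rule op_inj)
    show "V (comb x c y) \<in> P" "comb (V x) c (V y) \<in> P"
      using xy V_mem comb_mem by blast+
    show "op (V (comb x c y)) = op (comb (V x) c (V y))"
      unfolding op_V [OF comb_mem [OF xy]] op_comb [OF V_mem [OF xy(1)] V_mem [OF xy(2)]]
        op_V [OF xy(1)] op_V [OF xy(2)] ..
  qed
  show "inv_into P T \<in> bounded_ops n X N"
    unfolding V_def [symmetric] using V_mem V_comb V_bound by (rule bounded_opsI [where T = V and N = N and K = "1 / lam"])
  have "N (V f) / N f \<le> 1 / lam" if f: "f \<in> P" for f
  proof (cases "N f = 0")
    case True
    then show ?thesis using lam_pos by simp
  next
    case False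
    then have "N f > 0" using N [OF f] ip_nonneg [OF f] by simp
    then show ?thesis using V_bound [OF f] by (simp add: pos_divide_le_eq)
  qed
  moreover have "P \<noteq> {}"
    using zero_mem by (auto simp: prod_space_def PiE_eq_empty_iff)
  ultimately show "op_norm n X N (inv_into P T) \<le> 1 / lam"
    unfolding op_norm_def V_def [symmetric] by (intro cSUP_least) auto
qed

end

subsection \<open>Schur complements\<close>

lemma dual_space_linear:
  assumes "f \<in> dual_space X"
  shows "\<lbrakk>x \<in> X; y \<in> X\<rbrakk> \<Longrightarrow> f (x + y) = f x + f y" "x \<in> X \<Longrightarrow> f (c *\<^sub>R x) = c * f x"
  using assms by (simp_all add: dual_space_def)

text \<open>Membership in the dual space makes the quotients in \<open>dual_norm\<close> bounded
  above, so the supremum dominates each of them. At \<open>y = 0\<close> the quotient carries no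
  information and linearity is used instead.\<close>

lemma bounded_linear_dual_bound:
  assumes T: "bounded_linear_dual X Y T"
  obtains K where "K \<ge> 0" "\<And>x y. \<lbrakk>x \<in> X; y \<in> Y\<rbrakk> \<Longrightarrow> \<bar>T x y\<bar> \<le> K * norm x * norm y"
proof -
  from T have "\<exists>K. \<forall>x\<in>X. dual_norm Y (T x) \<le> K * norm x"
    by (simp add: bounded_linear_dual_def)
  then obtain K where K: "\<And>x. x \<in> X \<Longrightarrow> dual_norm Y (T x) \<le> K * norm x" by blast
  have "\<bar>T x y\<bar> \<le> \<bar>K\<bar> * norm x * norm y" if x: "x \<in> X" and y: "y \<in> Y" for x y
  proof (cases "y = 0")
    case True
    have "T x \<in> dual_space Y" using T x by (simp add: bounded_linear_dual_def)
    then have "T x y = 0" using dual_space_linear(2) [of "T x" Y y 0] y True by simp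
    then show ?thesis by simp
  next
    case False
    have "T x \<in> dual_space Y" using T x by (simp add: bounded_linear_dual_def)
    then have "\<exists>L. \<forall>z\<in>Y. \<bar>T x z\<bar> \<le> L * norm z" by (simp add: dual_space_def)
    then obtain L where L: "\<And>z. z \<in> Y \<Longrightarrow> \<bar>T x z\<bar> \<le> L * norm z" by blast
    have "\<bar>T x z\<bar> / norm z \<le> \<bar>L\<bar>" if "z \<in> Y" for z
    proof (cases "z = 0")
      case False
      have "\<bar>T x z\<bar> \<le> \<bar>L\<bar> * norm z"
        by (rule order_trans [OF L [OF that]]) (intro mult_right_mono, auto)
      then show ?thesis using False by (simp add: pos_divide_le_eq)
    qed simp
    then have "bdd_above ((\<lambda>z. \<bar>T x z\<bar> / norm z) ` Y)" by (auto intro!: bdd_aboveI)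
    then have "\<bar>T x y\<bar> / norm y \<le> dual_norm Y (T x)"
      unfolding dual_norm_def using y by (intro cSUP_upper)
    also have "\<dots> \<le> K * norm x" using K [OF x] .
    also have "\<dots> \<le> \<bar>K\<bar> * norm x" by (intro mult_right_mono) auto
    finally show ?thesis using False by (simp add: pos_divide_le_eq)
  qed
  then show ?thesis using that [of "\<bar>K\<bar>"] by simp
qed

lemma dual_adjoint_mem:
  assumes "subspace X" and B: "bounded_linear_dual X Y B" and y: "y \<in> Y"
  shows "dual_adjoint X B y \<in> dual_space X"
proof -
  obtain K where K: "\<And>x y. \<lbrakk>x \<in> X; y \<in> Y\<rbrakk> \<Longrightarrow> \<bar>B x y\<bar> \<le> K * norm x * norm y"
    using bounded_linear_dual_bound [OF B] by metis
  have "\<forall>x\<in>X. \<bar>B x y\<bar> \<le> (K * norm y) * norm x"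
    using K y by (simp add: mult_ac)
  then have "\<exists>L. \<forall>x\<in>X. \<bar>B x y\<bar> \<le> L * norm x" by blast
  then show ?thesis
    using assms by (simp add: dual_space_def dual_adjoint_def bounded_linear_dual_def
        subspace_add subspace_scale)
qed

text \<open>Linearity is asked for in the second argument, where it comes from values in the dual
  space. Symmetry carries it over to the first, in which a Schur complement involves an
  inverse.\<close>

lemma coercive_formI:
  assumes X: "hilbert_subspace X" and pd: "pos_def_on X s"
    and sym: "\<And>x y. \<lbrakk>x \<in> X; y \<in> X\<rbrakk> \<Longrightarrow> s x y = s y x"
    and add: "\<And>x y z. \<lbrakk>x \<in> X; y \<in> X; z \<in> X\<rbrakk> \<Longrightarrow> s z (x + y) = s z x + s z y"
    and scale: "\<And>x z c. \<lbrakk>x \<in> X; z \<in> X\<rbrakk> \<Longrightarrow> s z (c *\<^sub>R x) = c * s z x"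
    and bound: "\<And>x y. \<lbrakk>x \<in> X; y \<in> X\<rbrakk> \<Longrightarrow> \<bar>s x y\<bar> \<le> K * norm x * norm y"
  obtains \<sigma> where "coercive_form X s K \<sigma>"
proof -
  have sub: "subspace X" and cpl: "complete X" using X by (auto simp: hilbert_subspace_def)
  obtain \<sigma> where \<sigma>: "\<sigma> > 0" "\<And>x. x \<in> X \<Longrightarrow> \<sigma> * (norm x)\<^sup>2 \<le> s x x"
    using pd by (auto simp: pos_def_on_def)
  have "coercive_form X s K \<sigma>"
  proof
    fix x y z :: 'a and c :: real
    assume x: "x \<in> X" and z: "z \<in> X"
    show "s (c *\<^sub>R x) z = c * s x z"
      using sym [OF subspace_scale [OF sub x] z] sym [OF x z] scale x z by simp
    assume y: "y \<in> X"
    show "s (x + y) z = s x z + s y z"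
      using sym [OF subspace_add [OF sub x y] z] sym [OF x z] sym [OF y z] add x y z by simp
  next
    fix x assume x: "x \<in> X"
    have "0 \<le> \<sigma> * (norm x)\<^sup>2" using \<sigma>(1) by simp
    then show "0 \<le> s x x" using \<sigma>(2) [OF x] by linarith
    assume "s x x = 0"
    then have "\<sigma> * (norm x)\<^sup>2 \<le> 0" using \<sigma>(2) [OF x] by simp
    then show "x = 0" using \<sigma>(1) by (simp add: mult_le_0_iff)
  qed (use sub cpl sym bound \<sigma> in auto)
  then show ?thesis using that by blast
qed

text \<open>Induction on the size: the new last row and column contribute only the diagonal entry
  and its two neighbours.\<close>

lemma sum_tridiagonal:
  fixes b :: "nat \<Rightarrow> nat \<Rightarrow> 'a::comm_monoid_add"
  assumes "\<And>i j. \<lbrakk>i \<le> m; j \<le> m; i \<noteq> j; i \<noteq> Suc j; j \<noteq> Suc i\<rbrakk> \<Longrightarrow> b i j = 0"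
  shows "(\<Sum>i<Suc m. \<Sum>j<Suc m. b i j) =
    (\<Sum>i<Suc m. b i i) + (\<Sum>i<m. b (Suc i) i) + (\<Sum>i<m. b i (Suc i))"
  using assms
proof (induction m)
  case 0
  show ?case by simp
next
  case (Suc m)
  have col: "(\<Sum>i<Suc m. b i (Suc m)) = b m (Suc m)"
    using Suc.prems by (simp add: sum.neutral)
  have row: "(\<Sum>j<Suc m. b (Suc m) j) = b (Suc m) m"
    using Suc.prems by (simp add: sum.neutral)
  have "(\<Sum>i<Suc (Suc m). \<Sum>j<Suc (Suc m). b i j) =
      (\<Sum>i<Suc m. (\<Sum>j<Suc m. b i j) + b i (Suc m)) + ((\<Sum>j<Suc m. b (Suc m) j) + b (Suc m) (Suc m))"
    by (simp only: sum.lessThan_Suc [of _ "Suc m"])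
  also have "\<dots> = (\<Sum>i<Suc m. \<Sum>j<Suc m. b i j) + b m (Suc m) + (b (Suc m) m + b (Suc m) (Suc m))"
    unfolding sum.distrib col row ..
  also have "(\<Sum>i<Suc m. \<Sum>j<Suc m. b i j) =
      (\<Sum>i<Suc m. b i i) + (\<Sum>i<m. b (Suc i) i) + (\<Sum>i<m. b i (Suc i))"
    by (rule Suc.IH) (use Suc.prems in auto)
  finally show ?case
    by (simp add: ac_simps)
qed

locale schur_chain =
  fixes n :: nat
    and X :: "nat \<Rightarrow> 'h::real_inner set"
    and A B :: "nat \<Rightarrow> 'h \<Rightarrow> 'h \<Rightarrow> real"
  assumes n_pos: "n > 0"
    and hilbert: "i < n \<Longrightarrow> hilbert_subspace (X i)"
    and A_bounded: "i < n \<Longrightarrow> bounded_linear_dual (X i) (X i) (A i)"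
    and A_sym: "i < n \<Longrightarrow> self_adjoint_on (X i) (A i)"
    and A_nonneg: "i < n \<Longrightarrow> pos_semidef_on (X i) (A i)"
    and B_bounded: "Suc i < n \<Longrightarrow> bounded_linear_dual (X i) (X (Suc i)) (B i)"
    and pos_def: "i < n \<Longrightarrow> pos_def_on (X i) (schur X A B i)"
begin

abbreviation "S \<equiv> schur X A B"

text \<open>\<open>R i\<close> and the following \<open>U i\<close> are adjoint for the Schur scalar
  products because both pairings reduce to \<open>B i x y\<close>.\<close>

definition R :: "nat \<Rightarrow> 'h \<Rightarrow> 'h" where
  "R i y = inv_into (X i) (S i) (dual_adjoint (X i) (B i) y)"

definition U :: "nat \<Rightarrow> 'h \<Rightarrow> 'h" where
  "U i x = inv_into (X (Suc i)) (S (Suc i)) (B i x)"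

lemma A_dual: "\<lbrakk>i < n; x \<in> X i\<rbrakk> \<Longrightarrow> A i x \<in> dual_space (X i)"
  using A_bounded by (simp add: bounded_linear_dual_def)

lemma B_dual: "\<lbrakk>Suc i < n; x \<in> X i\<rbrakk> \<Longrightarrow> B i x \<in> dual_space (X (Suc i))"
  using B_bounded by (simp add: bounded_linear_dual_def)

lemma A_commute: "\<lbrakk>i < n; x \<in> X i; y \<in> X i\<rbrakk> \<Longrightarrow> A i x y = A i y x"
  using A_sym by (simp add: self_adjoint_on_def)

text \<open>Coercivity of \<open>S i\<close> is an explicit premise because the lemma serves the
  induction in \<open>schur_coercive\<close>, where it is known for block \<open>i\<close> but not
  yet in general.\<close>

lemma R_properties:
  assumes S: "coercive_form (X i) (S i) K \<sigma>" and ext: "\<forall>x\<in>X i. S i x \<in> extensional (X i)"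
    and i: "Suc i < n" and y: "y \<in> X (Suc i)"
  shows "R i y \<in> X i" "x \<in> X i \<Longrightarrow> S i (R i y) x = B i x y"
proof -
  interpret coercive_form "X i" "S i" K \<sigma> by fact
  have f: "dual_adjoint (X i) (B i) y \<in> dual_space (X i)"
    using dual_adjoint_mem [OF subspace B_bounded [OF i] y] .
  show "R i y \<in> X i" unfolding R_def by (rule inv_into_dual(1) [OF f ext])
  show "x \<in> X i \<Longrightarrow> S i (R i y) x = B i x y"
    unfolding R_def using inv_into_dual(2) [OF f ext, of x] by (simp add: dual_adjoint_def)
qed

text \<open>In the inductive step, symmetry comes from writing the \<open>B i\<close> term as
  \<open>S i (R i x) (R i y)\<close>, and boundedness from a norm bound on \<open>R i\<close>.
  Extensionality is carried along so that \<open>inv_into\<close> inverts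
  \<open>S i\<close>.\<close>

lemma schur_coercive:
  assumes "i < n"
  shows "(\<exists>K \<sigma>. coercive_form (X i) (S i) K \<sigma>) \<and> (\<forall>x\<in>X i. S i x \<in> extensional (X i))"
  using assms
proof (induction i)
  case 0
  obtain K where K: "\<And>x y. \<lbrakk>x \<in> X 0; y \<in> X 0\<rbrakk> \<Longrightarrow> \<bar>A 0 x y\<bar> \<le> K * norm x * norm y"
    using bounded_linear_dual_bound [OF A_bounded [OF 0]] by metis
  obtain \<sigma> where "coercive_form (X 0) (S 0) K \<sigma>"
  proof (rule coercive_formI [OF hilbert [OF 0] pos_def [OF 0], of K])
    show "S 0 x y = S 0 y x" if "x \<in> X 0" "y \<in> X 0" for x y
      using A_commute [OF 0 that] by simp
    show "S 0 z (x + y) = S 0 z x + S 0 z y" if "x \<in> X 0" "y \<in> X 0" "z \<in> X 0" for x y z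
      using dual_space_linear(1) [OF A_dual [OF 0 that(3)] that(1,2)] by simp
    show "S 0 z (c *\<^sub>R x) = c * S 0 z x" if "x \<in> X 0" "z \<in> X 0" for x z c
      using dual_space_linear(2) [OF A_dual [OF 0 that(2)] that(1)] by simp
    show "\<bar>S 0 x y\<bar> \<le> K * norm x * norm y" if "x \<in> X 0" "y \<in> X 0" for x y
      using K [OF that] by simp
  qed
  moreover have "\<forall>x\<in>X 0. S 0 x \<in> extensional (X 0)"
    using A_dual [OF 0] by (simp add: dual_space_def)
  ultimately show ?case by blast
next
  case (Suc i)
  then obtain K \<sigma> where S: "coercive_form (X i) (S i) K \<sigma>"
    and ext: "\<forall>x\<in>X i. S i x \<in> extensional (X i)" by auto
  interpret coercive_form "X i" "S i" K \<sigma> by fact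
  note R = R_properties [OF S ext Suc.prems]
  obtain KA where KA: "KA \<ge> 0" "\<And>x y. \<lbrakk>x \<in> X (Suc i); y \<in> X (Suc i)\<rbrakk> \<Longrightarrow> \<bar>A (Suc i) x y\<bar> \<le> KA * norm x * norm y"
    using bounded_linear_dual_bound [OF A_bounded [OF Suc.prems]] by metis
  obtain KB where KB: "KB \<ge> 0" "\<And>x y. \<lbrakk>x \<in> X i; y \<in> X (Suc i)\<rbrakk> \<Longrightarrow> \<bar>B i x y\<bar> \<le> KB * norm x * norm y"
    using bounded_linear_dual_bound [OF B_bounded [OF Suc.prems]] by metis
  have X': "subspace (X (Suc i))" using hilbert [OF Suc.prems] by (simp add: hilbert_subspace_def)
  have S_Suc: "S (Suc i) x y = A (Suc i) x y + B i (R i x) y" if "y \<in> X (Suc i)" for x y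
    using that by (simp add: R_def)
  \<comment> \<open>Coercivity is tested with \<open>R i y\<close> itself, and one factor
    \<open>norm (R i y)\<close> is cancelled.\<close>
  have R_bound: "norm (R i y) \<le> KB / \<sigma> * norm y" if y: "y \<in> X (Suc i)" for y
  proof (cases "R i y = 0")
    case True
    then show ?thesis using KB(1) \<sigma>_pos by simp
  next
    case False
    have "\<sigma> * (norm (R i y))\<^sup>2 \<le> S i (R i y) (R i y)" using R(1) [OF y] by (rule coercive)
    also have "\<dots> = B i (R i y) y" using R [OF y] by simp
    also have "\<dots> \<le> KB * norm (R i y) * norm y" using KB(2) [OF R(1) [OF y] y] by simp
    finally have "(\<sigma> * norm (R i y)) * norm (R i y) \<le> (KB * norm y) * norm (R i y)"
      by (simp add: power2_eq_square mult_ac)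
    then have "\<sigma> * norm (R i y) \<le> KB * norm y" using False by simp
    then show ?thesis using \<sigma>_pos by (simp add: field_simps)
  qed
  define K' where "K' = KA + KB * (KB / \<sigma>)"
  obtain \<tau> where "coercive_form (X (Suc i)) (S (Suc i)) K' \<tau>"
  proof (rule coercive_formI [OF hilbert [OF Suc.prems] pos_def [OF Suc.prems], of K'])
    fix x y assume x: "x \<in> X (Suc i)" and y: "y \<in> X (Suc i)"
    have "B i (R i x) y = S i (R i y) (R i x)" "B i (R i y) x = S i (R i x) (R i y)"
      using R x y by simp_all
    moreover have "S i (R i y) (R i x) = S i (R i x) (R i y)" using R x y by (intro commute) auto
    ultimately show "S (Suc i) x y = S (Suc i) y x"
      unfolding S_Suc [OF x] S_Suc [OF y] using A_commute [OF Suc.prems x y] by simp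
    have "\<bar>S (Suc i) x y\<bar> \<le> \<bar>A (Suc i) x y\<bar> + \<bar>B i (R i x) y\<bar>"
      unfolding S_Suc [OF y] by simp
    also have "\<dots> \<le> KA * norm x * norm y + KB * norm (R i x) * norm y"
      using KA(2) [OF x y] KB(2) [OF R(1) [OF x] y] by (rule add_mono)
    also have "\<dots> \<le> KA * norm x * norm y + KB * (KB / \<sigma> * norm x) * norm y"
      using R_bound [OF x] KB(1) by (intro add_left_mono mult_right_mono mult_left_mono) auto
    also have "\<dots> = K' * norm x * norm y" by (simp add: K'_def algebra_simps)
    finally show "\<bar>S (Suc i) x y\<bar> \<le> K' * norm x * norm y" .
    fix z assume z: "z \<in> X (Suc i)"
    show "S (Suc i) z (x + y) = S (Suc i) z x + S (Suc i) z y"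
      unfolding S_Suc [OF x] S_Suc [OF y] S_Suc [OF subspace_add [OF X' x y]]
      using x y z R(1) [OF z] dual_space_linear(1) [OF A_dual [OF Suc.prems z] x y]
        dual_space_linear(1) [OF B_dual [OF Suc.prems R(1) [OF z]] x y] by simp
  next
    fix x z c assume x: "x \<in> X (Suc i)" and z: "z \<in> X (Suc i)"
    show "S (Suc i) z (c *\<^sub>R x) = c * S (Suc i) z x"
      unfolding S_Suc [OF x] S_Suc [OF subspace_scale [OF X' x]]
      using dual_space_linear(2) [OF A_dual [OF Suc.prems z] x]
        dual_space_linear(2) [OF B_dual [OF Suc.prems R(1) [OF z]] x] by (simp add: distrib_left)
  qed
  moreover have "\<forall>x\<in>X (Suc i). S (Suc i) x \<in> extensional (X (Suc i))" by simp
  ultimately show ?case by blast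
qed

lemma coercive_form:
  assumes "i < n"
  obtains K \<sigma> where "coercive_form (X i) (S i) K \<sigma>"
  using schur_coercive [OF assms] by blast

lemma S_extensional: "i < n \<Longrightarrow> \<forall>x\<in>X i. S i x \<in> extensional (X i)"
  using schur_coercive by blast

lemma R_mem: "\<lbrakk>Suc i < n; y \<in> X (Suc i)\<rbrakk> \<Longrightarrow> R i y \<in> X i"
  by (metis R_properties(1) S_extensional Suc_lessD coercive_form)

lemma S_R: "\<lbrakk>Suc i < n; x \<in> X i; y \<in> X (Suc i)\<rbrakk> \<Longrightarrow> S i (R i y) x = B i x y"
  by (metis R_properties(2) S_extensional Suc_lessD coercive_form)

lemma U_properties:
  assumes i: "Suc i < n" and x: "x \<in> X i"
  shows "U i x \<in> X (Suc i)" "y \<in> X (Suc i) \<Longrightarrow> S (Suc i) (U i x) y = B i x y"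
proof -
  obtain K \<sigma> where "coercive_form (X (Suc i)) (S (Suc i)) K \<sigma>" using coercive_form [OF i] .
  then interpret coercive_form "X (Suc i)" "S (Suc i)" K \<sigma> .
  show "U i x \<in> X (Suc i)"
    unfolding U_def by (rule inv_into_dual(1) [OF B_dual [OF i x] S_extensional [OF i]])
  show "y \<in> X (Suc i) \<Longrightarrow> S (Suc i) (U i x) y = B i x y"
    unfolding U_def by (rule inv_into_dual(2) [OF B_dual [OF i x] S_extensional [OF i]])
qed

lemma S_scalar_product: "i < n \<Longrightarrow> scalar_product (X i) (S i)"
  by (metis coercive_form coercive_form.axioms(1))

text \<open>\<open>B\<^sub>i S\<^sub>i\<inverse> B\<^sub>i'\<close> is the Gram form of
  \<open>R i\<close>. With \<open>A (Suc i)\<close> positive semi-definite this makes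
  \<open>R i\<close> a contraction, and it lets \<open>A\<close> be eliminated in favour of
  \<open>S\<close>.\<close>

lemma schur_Suc:
  assumes i: "Suc i < n" and x: "x \<in> X (Suc i)" and y: "y \<in> X (Suc i)"
  shows "S (Suc i) x y = A (Suc i) x y + S i (R i x) (R i y)"
proof -
  have "B i (R i x) y = S i (R i y) (R i x)" using i x y by (simp add: S_R R_mem)
  also have "\<dots> = S i (R i x) (R i y)"
    using scalar_product.commute [OF S_scalar_product] i x y R_mem by simp
  finally show ?thesis using y by (simp add: R_def)
qed

sublocale contraction_chain n X S R U
proof (rule contraction_chain.intro)
  show "0 < n" by (rule n_pos)
  show "scalar_product (X i) (S i)" if "i < n" for i using S_scalar_product [OF that] .
  fix i y assume i: "Suc i < n" and y: "y \<in> X (Suc i)"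
  show "R i y \<in> X i" using R_mem [OF i y] .
  show "S i (R i y) (R i y) \<le> S (Suc i) y y"
    using schur_Suc [OF i y y] A_nonneg [OF i] y by (simp add: pos_semidef_on_def)
next
  fix i x assume i: "Suc i < n" and x: "x \<in> X i"
  show "U i x \<in> X (Suc i)" using U_properties i x by blast
  show "S i (R i y) x = S (Suc i) y (U i x)" if y: "y \<in> X (Suc i)" for y
  proof -
    have "S (Suc i) y (U i x) = S (Suc i) (U i x) y"
      using scalar_product.commute [OF S_scalar_product [OF i]] U_properties(1) [OF i x] y by blast
    then show ?thesis using U_properties(2) [OF i x y] S_R [OF i x y] by simp
  qed
qed

section \<open>Identification of the preconditioned operator\<close>

text \<open>The factorization in weak form: both sides are expanded into diagonal terms
  \<open>a\<close>, off-diagonal terms \<open>p\<close> and Gram terms \<open>r\<close>.\<close>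

lemma tridiag_sum:
  assumes x: "x \<in> P" and y: "y \<in> P"
  shows "(\<Sum>i<n. \<Sum>j<n. tridiag_block X A B i j (x j) (y i)) = ip (op x) y"
proof -
  obtain m where n: "n = Suc m" using n_pos by (cases n) auto
  have x': "x i \<in> X i" and y': "y i \<in> X i" if "i < n" for i
    using prod_spaceD x y that by simp_all
  define a where "a i = S i (x i) (y i)" for i
  define r where "r i = S i (R i (x (Suc i))) (R i (y (Suc i)))" for i
  define p where "p i = B i (x i) (y (Suc i)) + B i (y i) (x (Suc i))" for i
  have "(\<Sum>i<n. \<Sum>j<n. tridiag_block X A B i j (x j) (y i)) =
      (\<Sum>i<Suc m. tridiag_block X A B i i (x i) (y i)) +
      (\<Sum>i<m. tridiag_block X A B (Suc i) i (x i) (y (Suc i))) +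
      (\<Sum>i<m. tridiag_block X A B i (Suc i) (x (Suc i)) (y i))"
    unfolding n using y' by (intro sum_tridiagonal) (simp add: tridiag_block_def n)
  also have "(\<Sum>i<Suc m. tridiag_block X A B i i (x i) (y i)) = (\<Sum>i<Suc m. (-1) ^ i * A i (x i) (y i))"
    using y' by (intro sum.cong) (auto simp: tridiag_block_def n)
  also have "\<dots> = A 0 (x 0) (y 0) + (\<Sum>i<m. (-1) ^ Suc i * A (Suc i) (x (Suc i)) (y (Suc i)))"
    unfolding sum.lessThan_Suc_shift by simp
  \<comment> \<open>\<open>A (Suc i)\<close> is \<open>S (Suc i)\<close> minus the Gram form, and
    the minus sign turns \<open>(-1) ^ Suc i\<close> into \<open>(-1) ^ i\<close>.\<close>
  also have "\<dots> = a 0 + (\<Sum>i<m. (-1) ^ Suc i * a (Suc i) + (-1) ^ i * r i)"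
  proof -
    have "(-1) ^ Suc i * A (Suc i) (x (Suc i)) (y (Suc i)) = (-1) ^ Suc i * a (Suc i) + (-1) ^ i * r i"
      if "i < m" for i
      using schur_Suc [of i "x (Suc i)" "y (Suc i)"] x' y' that
      unfolding a_def r_def by (simp add: n algebra_simps del: schur.simps)
    then show ?thesis by (simp add: a_def)
  qed
  also have "\<dots> = (\<Sum>i<Suc m. (-1) ^ i * a i) + (\<Sum>i<m. (-1) ^ i * r i)"
    unfolding sum.lessThan_Suc_shift sum.distrib by simp
  also have "(\<Sum>i<m. tridiag_block X A B (Suc i) i (x i) (y (Suc i))) = (\<Sum>i<m. B i (x i) (y (Suc i)))"
    by (simp add: tridiag_block_def)
  also have "(\<Sum>i<m. tridiag_block X A B i (Suc i) (x (Suc i)) (y i)) = (\<Sum>i<m. B i (y i) (x (Suc i)))"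
    using y' by (intro sum.cong) (auto simp: tridiag_block_def dual_adjoint_def n)
  finally have lhs: "(\<Sum>i<n. \<Sum>j<n. tridiag_block X A B i j (x j) (y i)) =
      (\<Sum>i<m. (-1) ^ i * a i + p i + (-1) ^ i * r i) + (-1) ^ m * a m"
    by (simp add: p_def sum.distrib)
  \<comment> \<open>The sign in \<open>upper\<close> enters once in each cross term, cancelling the
    outer sign, and twice in the Gram term, leaving the outer sign there.\<close>
  have "(-1) ^ i * S i (upper x i) (upper y i) = (-1) ^ i * a i + p i + (-1) ^ i * r i" if "i < m" for i
  proof -
    have i: "Suc i < n" and i': "i < n" using that n by simp_all
    interpret scalar_product "X i" "S i" using S_scalar_product i' .
    have "upper z i = z i + (-1) ^ i *\<^sub>R R i (z (Suc i))" for z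
      using i by (simp add: upper_def)
    moreover have Rx: "R i (x (Suc i)) \<in> X i" and Ry: "R i (y (Suc i)) \<in> X i"
      using R_mem i x' y' by simp_all
    moreover have "S i (x i) (R i (y (Suc i))) = B i (x i) (y (Suc i))"
      using commute [OF x' [OF i'] Ry] S_R [OF i x' [OF i'] y' [OF i]] by simp
    moreover have "S i (R i (x (Suc i))) (y i) = B i (y i) (x (Suc i))"
      using S_R [OF i y' [OF i'] x' [OF i]] by simp
    moreover have "(-1) ^ i * ((-1) ^ i * c) = c" for c :: real
      by (simp flip: mult.assoc power_mult_distrib)
    ultimately show ?thesis
      using x' [OF i'] y' [OF i'] by (simp add: bilinear a_def p_def r_def distrib_left)
  qed
  moreover have "upper z m = z m" for z unfolding upper_def by (simp add: n)
  ultimately have "(\<Sum>i<n. (-1) ^ i * S i (upper x i) (upper y i)) =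
      (\<Sum>i<m. (-1) ^ i * a i + p i + (-1) ^ i * r i) + (-1) ^ m * a m"
    unfolding n sum.lessThan_Suc by (simp add: a_def)
  then show ?thesis using ip_op [OF x y] lhs by simp
qed

lemma schur_op_eq_ip: "y \<in> P \<Longrightarrow> schur_op n X A B x y = ip x y"
  by (simp add: schur_op_def ip_def)

lemma schur_op_inj: "inj_on (schur_op n X A B) P"
proof (rule inj_onI)
  fix x y assume x: "x \<in> P" and y: "y \<in> P" and eq: "schur_op n X A B x = schur_op n X A B y"
  have "ip x z = ip y z" if "z \<in> P" for z
    using schur_op_eq_ip [OF that] eq by metis
  then have "ip (comb x (-1) y) (comb x (-1) y) = 0"
    using x y by (simp add: ip_comb)
  then show "x = y" using ip_definite x y by blast
qed

text \<open>By \<open>tridiag_sum\<close>, \<open>schur_op\<close> sends \<open>op x\<close> to the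
  functional given by \<open>tridiag_op\<close>; injectivity on \<open>P\<close> makes
  \<open>op x\<close> the value that \<open>inv_into\<close> picks.\<close>

lemma precond_op_eq:
  assumes x: "x \<in> P"
  shows "precond_op n X A B x = op x"
proof -
  have "schur_op n X A B (op x) = tridiag_op n X A B x"
    using tridiag_sum [OF x] by (auto simp: fun_eq_iff schur_op_def tridiag_op_def ip_def)
  then show ?thesis
    unfolding precond_op_def using schur_op_inj op_mem [OF x] by (metis inv_into_f_f)
qed

lemma schur_norm_eq: "x \<in> P \<Longrightarrow> schur_norm n X A B x = sqrt (ip x x)"
  by (simp add: schur_norm_def schur_op_eq_ip)

end

theorem theorem2p2:
  fixes n :: nat
    and X :: "nat \<Rightarrow> 'h::real_inner set"
    and A B :: "nat \<Rightarrow> 'h \<Rightarrow> 'h \<Rightarrow> real"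
  assumes "n \<ge> 2"
    and "\<And>i. i < n \<Longrightarrow> hilbert_subspace (X i)"
    and "\<And>i. i < n \<Longrightarrow> bounded_linear_dual (X i) (X i) (A i)"
    and "\<And>i. i < n \<Longrightarrow> self_adjoint_on (X i) (A i)"
    and "\<And>i. i < n \<Longrightarrow> pos_semidef_on (X i) (A i)"
    and "\<And>i. Suc i < n \<Longrightarrow> bounded_linear_dual (X i) (X (Suc i)) (B i)"
    and "\<And>i. i < n \<Longrightarrow> pos_def_on (X i) (schur X A B i)"
  shows "precond_op n X A B \<in> bounded_ops n X (schur_norm n X A B) \<and>
         bij_betw (precond_op n X A B) (prod_space n X) (prod_space n X) \<and>
         inv_into (prod_space n X) (precond_op n X A B) \<in> bounded_ops n X (schur_norm n X A B) \<and>
         op_norm n X (schur_norm n X A B) (inv_into (prod_space n X) (precond_op n X A B))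
           \<le> 1 / (2 * sin (pi / (2 * (2 * real n + 1))))"
proof -
  interpret schur_chain n X A B
    using assms by unfold_locales auto
  show ?thesis
    using inverse_bounded [OF schur_norm_eq precond_op_eq] unfolding lam_def by blast
qed

end
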